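(* Let $\mathcal K=\{\partial_t+f(t,\mathbf x,\mathbf u)\,\partial_{\mathbf x},\ \partial_{\mathbf u}\}\subset T(\mathbb R_t\times M)$ arise from any smooth control system $\frac{d\mathbf x}{dt}=f(t,\mathbf x,\mathbf u)$, where $M$ is the manifold of states $\mathbf x$ and controls $\mathbf u$. A necessary condition in order that $\mathcal K$ be static feedback equivalent to a Brunovsky normal form is that [i] $\mathcal K$ is a Goursat bundle; and [ii] if $k$ is the derived length of $\mathcal K$ and $\mathrm{deccel}(\mathcal K)=\langle\rho_1,\ldots,\rho_k\rangle$, then $dt\in(\mathrm{Char}\,\mathcal K^{(k-1)})^\perp$ if $\rho_k=1$, or $dt\in\Upsilon_{\widehat\Sigma_{k-1}}(\mathcal K^{(k-1)})$ if $\rho_k>1$.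
   Context: Everything is smooth ($C^\infty$). $\{X,Y,\ldots\}$ denotes the sub-bundle of the tangent bundle whose sections are the $C^\infty$-module generated by the listed vector fields; $f\,\partial_{\mathbf x}=\sum_i f^i\partial_{x_i}$ and $\partial_{\mathbf u}$ stands for all $\partial_{u^a}$. $^\perp$ denotes the annihilator in the cotangent bundle. **Static feedback.** A static feedback transformation is a local diffeomorphism of the form $t\mapsto t$, $\mathbf x\mapsto\Phi(\mathbf x)$, $\mathbf u\mapsto\Psi(\mathbf x,\mathbf u)$. A Brunovsky normal form is a partial prolongation $\mathcal C(\tau)$ (defined below), viewed as a control system whose time is the independent variable $x$, whose states are the $z^{l_j,j}_h$ with $h<j$ and whose controls are the $z^{l_j,j}_j$. $\mathcal K$ is static feedback equivalent to a Brunovsky normal form if there is a static feedback transformation $\vartheta$ (with $\vartheta^*x=t$) such that $\vartheta_*\mathcal K=\mathcal C(\tau)$ for some $\tau$. All equivalences are local. **Derived flag and Cauchy bundles.** For a sub-bundle $\mathcal V\subset TN$ over a manifold $N$, the structure tensor is $\delta_0:\mathcal V\times\mathcal V\to TN/\mathcal V$, $\delta_0(X,Y)=[X,Y]\bmod\mathcal V$. If it has constant rank, the first derived bundle $\mathcal V^{(1)}$ is the sub-bundle whose sections are generated by sections of $\mathcal V$ and their brackets; iterating gives $\mathcal V=\mathcal V^{(0)}\subset\mathcal V^{(1)}\subset\cdots$. $\mathcal V$ is regular if all the structure tensors of the $\mathcal V^{(i)}$ have constant rank; the derived length is the least $k$ with $\mathcal V^{(k+1)}=\mathcal V^{(k)}$.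 The Cauchy bundle $\mathrm{Char}\,\mathcal V$ is the bundle (when of constant rank) whose sections are those sections $X$ of $\mathcal V$ with $[X,\Gamma(\mathcal V)]\subseteq\Gamma(\mathcal V)$. $\mathcal V$ is totally regular if it is regular and every $\mathcal V^{(i)}$ has a Cauchy bundle of constant rank. Put $m_i=\dim\mathcal V^{(i)}$, $\chi^i=\dim\mathrm{Char}\,\mathcal V^{(i)}$ (fibre dimensions), and for $1\le j\le k-1$ put $\mathrm{Char}\,\mathcal V^{(j)}_{j-1}=\mathcal V^{(j-1)}\cap\mathrm{Char}\,\mathcal V^{(j)}$. **Decceleration.** With $\Delta_j=m_j-m_{j-1}$ ($1\le j\le k$) and $\Delta^2_i=\Delta_i-\Delta_{i-1}$ ($2\le i\le k$), $\mathrm{deccel}(\mathcal V)=\langle-\Delta^2_2,\ldots,-\Delta^2_k,\Delta_k\rangle$. **Partial prolongations.** For a list $\tau=\langle\rho_1,\ldots,\rho_k\rangle$ of non-negative integers with $\rho_k\ge1$, the partial prolongation $\mathcal C(\tau)$ is the distribution $$\mathcal C(\tau)=\Big\{\partial_x+\sum_{j:\rho_j>0}\ \sum_{l_j=1}^{\rho_j}\ \sum_{h=0}^{j-1}z^{l_j,j}_{h+1}\,\partial_{z^{l_j,j}_h},\ \ \partial_{z^{l_j,j}_j}\ (\rho_j>0,\ 1\le l_j\le\rho_j)\Big\}$$ on the space with coordinates $x,\ z^{l_j,j}_h$ ($\rho_j>0$, $1\le l_j\le\rho_j$, $0\le h\le j$). **Singular variety of a quotient; Weber structures.** For a totally regular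 $\mathcal W\subset TN$, let $\widehat\pi:TN\to\widehat{TN}:=TN/\mathrm{Char}\,\mathcal W$ be the projection, $\widehat{\mathcal W}=\mathcal W/\mathrm{Char}\,\mathcal W$, and let $\widehat\delta:\widehat{\mathcal W}\times\widehat{\mathcal W}\to\widehat{TN}/\widehat{\mathcal W}$, $\widehat\delta(\widehat\pi X,\widehat\pi Y)=\widehat\pi([X,Y])\bmod\widehat{\mathcal W}$. A line $[\widehat X]\in\mathbb P\widehat{\mathcal W}$ is singular if the linear map $\widehat Y\mapsto\widehat\delta(\widehat X,\widehat Y)$ has less than generic rank; $\mathrm{Sing}(\widehat{\mathcal W})$ is the set of singular lines. A Weber structure is a totally regular $\mathcal W\subset TN$ of rank $c+q+1$ ($q\ge2$, $c\ge0$), $\dim N=c+2q+1$, with $\dim\mathrm{Char}\,\mathcal W=c$, $\mathcal W^{(1)}=TN$ and $\widehat\Sigma:=\mathrm{Sing}(\widehat{\mathcal W})=\mathbb P\widehat{\mathcal B}\approx\mathbb{RP}^{q-1}$ for some rank $q$ sub-bundle $\widehat{\mathcal B}\subset\widehat{\mathcal W}$ (the singular sub-bundle). Its resolvent bundle $\mathcal R_{\widehat\Sigma}(\mathcal W)\subset\mathcal W$ is the largest sub-bundle with $\widehat\pi(\mathcal R_{\widehat\Sigma}(\mathcal W))=\widehat{\mathcal B}$. The Weber structure is integrable if its resolvent bundle is integrable. **Goursat bundles.** A totally regular $\mathcal V\subset TN$ of derived length $k$, with $\mathcal V^{(k)}=TN$, is a Goursat bundle of type $\tau$ if: (i) $\mathcal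 V$ has the derived type of a partial prolongation of type $\tau=\mathrm{deccel}(\mathcal V)$, i.e. its ranks $m_i,\chi^i$ agree with those of $\mathcal C(\tau)$; (ii) each $\mathrm{Char}\,\mathcal V^{(i)}_{i-1}$, $1\le i\le k-1$, is an integrable sub-bundle of constant rank agreeing with the corresponding rank for $\mathcal C(\tau)$; (iii) if $\Delta_k>1$, then $\mathcal V^{(k-1)}$ determines an integrable Weber structure on $N$ with singular sub-bundle satisfying $\mathbb P\widehat{\mathcal B}\approx\mathbb{RP}^{\Delta_k-1}$. In case (iii), $\Upsilon_{\widehat\Sigma_{k-1}}(\mathcal V^{(k-1)}):=\mathcal R_{\widehat\Sigma_{k-1}}(\mathcal V^{(k-1)})^\perp$ is the annihilator of the resolvent bundle of the Weber structure $(\mathcal V^{(k-1)},\widehat\Sigma_{k-1})$, $\widehat\Sigma_{k-1}=\mathrm{Sing}(\widehat{\mathcal V}^{(k-1)})$, $\widehat{\mathcal V}^{(k-1)}=\mathcal V^{(k-1)}/\mathrm{Char}\,\mathcal V^{(k-1)}$. *)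

theory Defs
  imports "HOL-Analysis.Analysis"
begin

text \<open>
  Everything is local, so manifolds are open subsets \<open>U\<close> of a Euclidean space and every
  tangent space is that Euclidean space itself.  A distribution assigns to each point a set of
  tangent vectors; all notions below look at it on \<open>U\<close> only.
\<close>

section \<open>Smooth maps, vector fields and sub-bundles\<close>

primrec Ck_on :: "nat \<Rightarrow> 'a::real_normed_vector set \<Rightarrow> ('a \<Rightarrow> 'b::real_normed_vector) \<Rightarrow> bool" where
  "Ck_on 0 U f \<longleftrightarrow> continuous_on U f"
| "Ck_on (Suc k) U f \<longleftrightarrow>
     (\<forall>x\<in>U. f differentiable (at x)) \<and> (\<forall>v. Ck_on k U (\<lambda>x. frechet_derivative f (at x) v))"

definition smooth_on :: "'a::real_normed_vector set \<Rightarrow> ('a \<Rightarrow> 'b::real_normed_vector) \<Rightarrow> bool" where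
  "smooth_on U f \<longleftrightarrow> (\<forall>k. Ck_on k U f)"

definition diffeo_on :: "'a::real_normed_vector set \<Rightarrow> ('a \<Rightarrow> 'b::real_normed_vector) \<Rightarrow> bool" where
  "diffeo_on U \<phi> \<longleftrightarrow> open U \<and> smooth_on U \<phi> \<and> inj_on \<phi> U \<and> open (\<phi> ` U) \<and>
     smooth_on (\<phi> ` U) (the_inv_into U \<phi>)"

type_synonym 'a distrib = "'a \<Rightarrow> 'a set"

text \<open>A sub-bundle of rank \<open>r\<close> is a distribution with smooth local frames of \<open>r\<close> elements.\<close>

definition sub_bundle :: "'a::euclidean_space set \<Rightarrow> nat \<Rightarrow> 'a distrib \<Rightarrow> bool" where
  "sub_bundle U r V \<longleftrightarrow>
     (\<forall>p\<in>U. \<exists>S. open S \<and> p \<in> S \<and> S \<subseteq> U \<and>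
        (\<exists>X::nat \<Rightarrow> 'a \<Rightarrow> 'a. (\<forall>i<r. smooth_on S (X i)) \<and>
           (\<forall>q\<in>S. V q = span ((\<lambda>i. X i q) ` {..<r}) \<and> dim (V q) = r)))"

definition bundle_rank :: "'a::euclidean_space set \<Rightarrow> 'a distrib \<Rightarrow> nat" where
  "bundle_rank U V = (THE r. \<forall>p\<in>U. dim (V p) = r)"

definition sections :: "'a::euclidean_space set \<Rightarrow> 'a distrib \<Rightarrow> ('a \<Rightarrow> 'a) set" where
  "sections U V = {X. smooth_on U X \<and> (\<forall>p\<in>U. X p \<in> V p)}"

definition lie_bracket :: "('a::euclidean_space \<Rightarrow> 'a) \<Rightarrow> ('a \<Rightarrow> 'a) \<Rightarrow> 'a \<Rightarrow> 'a" where
  "lie_bracket X Y p =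
     frechet_derivative Y (at p) (X p) - frechet_derivative X (at p) (Y p)"

text \<open>
  Integrability in the sense of foliations: around each point there is a chart that carries the
  distribution to a constant one, so that the leaves are the slices of the chart.
\<close>

definition integrable_distrib :: "'a::euclidean_space set \<Rightarrow> 'a distrib \<Rightarrow> bool" where
  "integrable_distrib U V \<longleftrightarrow>
     (\<forall>p\<in>U. \<exists>S (\<phi>::'a \<Rightarrow> 'a) L. p \<in> S \<and> S \<subseteq> U \<and> diffeo_on S \<phi> \<and> subspace L \<and>
        (\<forall>q\<in>S. frechet_derivative \<phi> (at q) ` V q = L))"

definition annihilator :: "'a::euclidean_space set \<Rightarrow> ('a \<Rightarrow> real) set" where
  "annihilator S = {\<omega>. linear \<omega> \<and> (\<forall>v\<in>S. \<omega> v = 0)}"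


section \<open>Quotients by a subspace\<close>

text \<open>The projection \<open>v \<mapsto> v + C\<close> onto the quotient by a subspace \<open>C\<close>.\<close>

definition coset :: "'a::euclidean_space set \<Rightarrow> 'a \<Rightarrow> 'a set" where
  "coset C v = (\<lambda>w. v + w) ` C"

text \<open>The dimension of the image of \<open>span S\<close> in the quotient by \<open>C\<close>.\<close>

definition quot_dim :: "'a::euclidean_space set \<Rightarrow> 'a set \<Rightarrow> nat" where
  "quot_dim C S = dim (S \<union> C) - dim C"

text \<open>
  The lines of a linear subspace \<open>B\<close> of the quotient by \<open>C\<close>, each given as the image of a line
  \<open>span {v}\<close> whose direction is nonzero modulo \<open>C\<close>.
\<close>

definition quot_lines :: "'a::euclidean_space set \<Rightarrow> 'a set set \<Rightarrow> 'a set set set" where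
  "quot_lines C B = {coset C ` span {v} |v. v \<notin> C \<and> coset C v \<in> B}"

text \<open>\<open>B\<close> is a sub-bundle of rank \<open>r\<close> of the quotient bundle \<open>W/C\<close>.\<close>

definition quot_sub_bundle ::
    "'a::euclidean_space set \<Rightarrow> 'a distrib \<Rightarrow> 'a distrib \<Rightarrow> nat \<Rightarrow> ('a \<Rightarrow> 'a set set) \<Rightarrow> bool" where
  "quot_sub_bundle U W C r B \<longleftrightarrow>
     (\<forall>p\<in>U. \<exists>S. open S \<and> p \<in> S \<and> S \<subseteq> U \<and>
        (\<exists>X::nat \<Rightarrow> 'a \<Rightarrow> 'a. (\<forall>i<r. X i \<in> sections S W) \<and>
           (\<forall>q\<in>S. B q = coset (C q) ` span ((\<lambda>i. X i q) ` {..<r}) \<and>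
                   quot_dim (C q) ((\<lambda>i. X i q) ` {..<r}) = r)))"


section \<open>Derived flag and Cauchy bundles\<close>

definition brackets :: "'a::euclidean_space set \<Rightarrow> 'a distrib \<Rightarrow> 'a distrib" where
  "brackets U V p = {lie_bracket X Y p |X Y. X \<in> sections U V \<and> Y \<in> sections U V}"

definition structure_rank :: "'a::euclidean_space set \<Rightarrow> 'a distrib \<Rightarrow> 'a \<Rightarrow> nat" where
  "structure_rank U V p = quot_dim (V p) (brackets U V p)"

definition derived_bundle :: "'a::euclidean_space set \<Rightarrow> 'a distrib \<Rightarrow> 'a distrib" where
  "derived_bundle U V p = span ({X p |X. X \<in> sections U V} \<union> brackets U V p)"

definition derived_flag :: "'a::euclidean_space set \<Rightarrow> 'a distrib \<Rightarrow> nat \<Rightarrow> 'a distrib" where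
  "derived_flag U V i = (derived_bundle U ^^ i) V"

definition cauchy_bundle :: "'a::euclidean_space set \<Rightarrow> 'a distrib \<Rightarrow> 'a distrib" where
  "cauchy_bundle U V p =
     {X p |X. X \<in> sections U V \<and> (\<forall>Y\<in>sections U V. lie_bracket X Y \<in> sections U V)}"

definition regular_distrib :: "'a::euclidean_space set \<Rightarrow> 'a distrib \<Rightarrow> bool" where
  "regular_distrib U V \<longleftrightarrow>
     (\<forall>i. (\<exists>r. sub_bundle U r (derived_flag U V i)) \<and>
          (\<exists>s. \<forall>p\<in>U. structure_rank U (derived_flag U V i) p = s))"

definition totally_regular :: "'a::euclidean_space set \<Rightarrow> 'a distrib \<Rightarrow> bool" where
  "totally_regular U V \<longleftrightarrow> regular_distrib U V \<and>
     (\<forall>i. \<exists>r. sub_bundle U r (cauchy_bundle U (derived_flag U V i)))"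

definition derived_length :: "'a::euclidean_space set \<Rightarrow> 'a distrib \<Rightarrow> nat" where
  "derived_length U V =
     (LEAST k. \<forall>p\<in>U. derived_flag U V (Suc k) p = derived_flag U V k p)"

text \<open>The intersection of the \<open>(j - 1)\<close>-st derived bundle with the Cauchy bundle of the
  \<open>j\<close>-th, for \<open>j \<ge> 1\<close>.\<close>

definition cauchy_inter :: "'a::euclidean_space set \<Rightarrow> 'a distrib \<Rightarrow> nat \<Rightarrow> 'a distrib" where
  "cauchy_inter U V j p =
     derived_flag U V (j - 1) p \<inter> cauchy_bundle U (derived_flag U V j) p"

definition m_rank :: "'a::euclidean_space set \<Rightarrow> 'a distrib \<Rightarrow> nat \<Rightarrow> nat" where
  "m_rank U V i = bundle_rank U (derived_flag U V i)"

definition chi_rank :: "'a::euclidean_space set \<Rightarrow> 'a distrib \<Rightarrow> nat \<Rightarrow> nat" where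
  "chi_rank U V i = bundle_rank U (cauchy_bundle U (derived_flag U V i))"

definition Delta :: "'a::euclidean_space set \<Rightarrow> 'a distrib \<Rightarrow> nat \<Rightarrow> int" where
  "Delta U V j = int (m_rank U V j) - int (m_rank U V (j - 1))"

definition deccel :: "'a::euclidean_space set \<Rightarrow> 'a distrib \<Rightarrow> int list" where
  "deccel U V = (let k = derived_length U V in
     map (\<lambda>i. - (Delta U V i - Delta U V (i - 1))) [2..<Suc k] @ [Delta U V k])"


section \<open>Partial prolongations\<close>

text \<open>
  A type \<open>\<langle>\<rho>\<^sub>1, \<dots>, \<rho>\<^sub>k\<rangle>\<close> is a list \<open>\<tau>\<close> with \<open>\<rho>\<^sub>j = \<tau> ! (j - 1)\<close>.
  \<open>Cz l j h\<close> names the coordinate with upper indices \<open>l, j\<close> and lower index \<open>h\<close>.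
\<close>

datatype jet_coord = Cx | Cz nat nat nat

definition prolongation_type :: "nat list \<Rightarrow> bool" where
  "prolongation_type \<tau> \<longleftrightarrow> \<tau> \<noteq> [] \<and> last \<tau> \<ge> 1"

definition jet_coords :: "nat list \<Rightarrow> jet_coord set" where
  "jet_coords \<tau> = insert Cx
     {Cz l j h |l j h. j \<in> {1..length \<tau>} \<and> l \<in> {1..\<tau> ! (j - 1)} \<and> h \<le> j}"

text \<open>
  The space of the partial prolongation is realised on any Euclidean space of the right
  dimension: a labelling \<open>e\<close>, bijective from \<open>jet_coords \<tau>\<close> onto the standard basis, sends a
  coordinate \<open>c\<close> to its coordinate vector field \<open>e c\<close>, and \<open>p \<bullet> e c\<close> is its value at \<open>p\<close>.
\<close>

definition coord_labelling :: "nat list \<Rightarrow> (jet_coord \<Rightarrow> 'a::euclidean_space) \<Rightarrow> bool" where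
  "coord_labelling \<tau> e \<longleftrightarrow> bij_betw e (jet_coords \<tau>) Basis"

definition partial_prolongation ::
    "nat list \<Rightarrow> (jet_coord \<Rightarrow> 'a::euclidean_space) \<Rightarrow> 'a distrib" where
  "partial_prolongation \<tau> e p =
     span (insert
       (e Cx + (\<Sum>j=1..length \<tau>. \<Sum>l=1..\<tau> ! (j - 1). \<Sum>h<j.
                 (p \<bullet> e (Cz l j (Suc h))) *\<^sub>R e (Cz l j h)))
       {e (Cz l j j) |l j. j \<in> {1..length \<tau>} \<and> l \<in> {1..\<tau> ! (j - 1)}})"


section \<open>Singular variety and Weber structures\<close>

text \<open>
  The rank of \<open>Y \<mapsto> \<delta>(v, Y)\<close> for the quotient structure tensor \<open>\<delta>\<close> at \<open>p\<close> and a
  representative \<open>v \<in> W p\<close>; its values lie in \<open>(TN/Char W)/(W/Char W) = TN/W\<close>.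
\<close>

definition polar_rank :: "'a::euclidean_space set \<Rightarrow> 'a distrib \<Rightarrow> 'a \<Rightarrow> 'a \<Rightarrow> nat" where
  "polar_rank U W p v =
     quot_dim (W p) {lie_bracket X Y p |X Y. X \<in> sections U W \<and> Y \<in> sections U W \<and> X p = v}"

definition generic_rank :: "'a::euclidean_space set \<Rightarrow> 'a distrib \<Rightarrow> 'a \<Rightarrow> nat" where
  "generic_rank U W p = Max (polar_rank U W p ` (W p - cauchy_bundle U W p))"

definition sing_lines :: "'a::euclidean_space set \<Rightarrow> 'a distrib \<Rightarrow> 'a \<Rightarrow> 'a set set set" where
  "sing_lines U W p =
     {coset (cauchy_bundle U W p) ` span {v} |v.
        v \<in> W p - cauchy_bundle U W p \<and> polar_rank U W p v < generic_rank U W p}"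

text \<open>\<open>B\<close> is the singular sub-bundle; it lives in \<open>W/Char W\<close>.\<close>

definition weber_structure ::
    "'a::euclidean_space set \<Rightarrow> 'a distrib \<Rightarrow> nat \<Rightarrow> nat \<Rightarrow> ('a \<Rightarrow> 'a set set) \<Rightarrow> bool" where
  "weber_structure U W c q B \<longleftrightarrow>
     totally_regular U W \<and> q \<ge> 2 \<and>
     sub_bundle U (c + q + 1) W \<and> DIM('a) = c + 2 * q + 1 \<and>
     sub_bundle U c (cauchy_bundle U W) \<and>
     (\<forall>p\<in>U. derived_flag U W 1 p = UNIV) \<and>
     quot_sub_bundle U W (cauchy_bundle U W) q B \<and>
     (\<forall>p\<in>U. sing_lines U W p = quot_lines (cauchy_bundle U W p) (B p))"

definition lifts_to ::
    "'a::euclidean_space set \<Rightarrow> 'a distrib \<Rightarrow> ('a \<Rightarrow> 'a set set) \<Rightarrow> 'a distrib \<Rightarrow> bool" where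
  "lifts_to U W B R \<longleftrightarrow> (\<exists>r. sub_bundle U r R) \<and>
     (\<forall>p\<in>U. R p \<subseteq> W p \<and> coset (cauchy_bundle U W p) ` R p = B p)"

definition resolvent_bundle ::
    "'a::euclidean_space set \<Rightarrow> 'a distrib \<Rightarrow> ('a \<Rightarrow> 'a set set) \<Rightarrow> 'a distrib \<Rightarrow> bool" where
  "resolvent_bundle U W B R \<longleftrightarrow> lifts_to U W B R \<and>
     (\<forall>R'. lifts_to U W B R' \<longrightarrow> (\<forall>p\<in>U. R' p \<subseteq> R p))"


section \<open>Goursat bundles\<close>

definition goursat_bundle_of_type :: "'a::euclidean_space set \<Rightarrow> 'a distrib \<Rightarrow> nat list \<Rightarrow> bool" where
  "goursat_bundle_of_type U V \<tau> \<longleftrightarrow> (let k = derived_length U V; W = derived_flag U V (k - 1) in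
     totally_regular U V \<and> (\<forall>p\<in>U. derived_flag U V k p = UNIV) \<and>
     prolongation_type \<tau> \<and> map int \<tau> = deccel U V \<and>
     (\<exists>e::jet_coord \<Rightarrow> 'a. coord_labelling \<tau> e \<and>
        (\<forall>i. m_rank U V i = m_rank UNIV (partial_prolongation \<tau> e) i \<and>
             chi_rank U V i = chi_rank UNIV (partial_prolongation \<tau> e) i) \<and>
        (\<forall>i\<in>{1..k - 1}. integrable_distrib U (cauchy_inter U V i) \<and>
             sub_bundle U (bundle_rank UNIV (cauchy_inter UNIV (partial_prolongation \<tau> e) i))
               (cauchy_inter U V i))) \<and>
     (Delta U V k > 1 \<longrightarrow>
        (\<exists>c B R. weber_structure U W c (nat (Delta U V k)) B \<and>
                 resolvent_bundle U W B R \<and> integrable_distrib U R)))"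

definition goursat_bundle :: "'a::euclidean_space set \<Rightarrow> 'a distrib \<Rightarrow> bool" where
  "goursat_bundle U V \<longleftrightarrow> (\<exists>\<tau>. goursat_bundle_of_type U V \<tau>)"


section \<open>Control systems and static feedback\<close>

text \<open>Points of the space are triples \<open>(t, x, u)\<close> of time, states and controls.\<close>

definition control_distrib ::
    "(real \<Rightarrow> real^'n \<Rightarrow> real^'m \<Rightarrow> real^'n) \<Rightarrow> (real \<times> (real^'n) \<times> (real^'m)) distrib" where
  "control_distrib f = (\<lambda>(t, x, u).
     span (insert (1, f t x u, 0) (range (\<lambda>a. (0, 0, axis a 1)))))"

definition dt :: "real \<times> (real^'n) \<times> (real^'m) \<Rightarrow> real" where
  "dt = fst"

definition static_feedback ::
    "(real \<times> (real^'n) \<times> (real^'m)) set \<Rightarrow>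
     (real \<times> (real^'n) \<times> (real^'m) \<Rightarrow> real \<times> (real^'n) \<times> (real^'m)) \<Rightarrow> bool" where
  "static_feedback U \<theta> \<longleftrightarrow> diffeo_on U \<theta> \<and>
     (\<exists>\<Phi> \<Psi>. \<forall>t x u. (t, x, u) \<in> U \<longrightarrow> \<theta> (t, x, u) = (t, \<Phi> x, \<Psi> x u))"

text \<open>
  The labelling which makes a partial prolongation a control system: time is \<open>Cx\<close>, the states
  are the \<open>Cz l j h\<close> with \<open>h < j\<close> and the controls are the \<open>Cz l j j\<close>.
\<close>

definition brunovsky_labelling ::
    "nat list \<Rightarrow> (jet_coord \<Rightarrow> real \<times> (real^'n) \<times> (real^'m)) \<Rightarrow> bool" where
  "brunovsky_labelling \<tau> e \<longleftrightarrow> coord_labelling \<tau> e \<and> e Cx = (1, 0, 0) \<and>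
     (\<forall>l j h. Cz l j h \<in> jet_coords \<tau> \<longrightarrow>
        (h < j \<longrightarrow> e (Cz l j h) \<in> range (\<lambda>i. (0, axis i 1, 0))) \<and>
        (h = j \<longrightarrow> e (Cz l j h) \<in> range (\<lambda>a. (0, 0, axis a 1))))"

definition static_feedback_equivalent_brunovsky ::
    "(real \<times> (real^'n) \<times> (real^'m)) set \<Rightarrow> (real \<times> (real^'n) \<times> (real^'m)) distrib \<Rightarrow> bool" where
  "static_feedback_equivalent_brunovsky U V \<longleftrightarrow>
     (\<exists>\<theta> \<tau> e. static_feedback U \<theta> \<and> prolongation_type \<tau> \<and> brunovsky_labelling \<tau> e \<and>
        (\<forall>p\<in>U. frechet_derivative \<theta> (at p) ` V p = partial_prolongation \<tau> e (\<theta> p)))"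

end

theory Submission
  imports Defs
begin

text \<open>
  A Brunovsky normal form is a linear control system. At the point \<open>y\<close> it is spanned by the drift
  \<open>e\<^sub>0 + N y\<close> and a constant space \<open>L\<^sub>0\<close> of control directions, where \<open>e\<^sub>0\<close> is the time direction and
  \<open>N\<close> is the linear map that sends \<open>\<partial>/\<partial>z\<^sub>h\<close> to \<open>\<partial>/\<partial>z\<^sub>h\<^sub>-\<^sub>1\<close> and kills \<open>\<partial>/\<partial>z\<^sub>0\<close>. For any space \<open>L\<close> of
  directions orthogonal to \<open>e\<^sub>0\<close>, two sections \<open>a D + b\<close> and \<open>a' D + b'\<close> of the distribution spanned
  by the drift \<open>D\<close> and \<open>L\<close> (with \<open>b\<close>, \<open>b'\<close> in \<open>L\<close>) have the bracket \<open>a' N b - a N b'\<close> modulo the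
  distribution (\<open>J_bracket_mod\<close>). All invariants in the theorem follow from this one formula by
  linear algebra:

  \<^item> the derived bundle replaces \<open>L\<close> by \<open>L + N L\<close> (\<open>derived_affine\<close>);

  \<^item> unless \<open>N L \<subseteq> L\<close>, the Cauchy bundle is the constant space of those \<open>l \<in> L\<close> with \<open>N l \<in> L\<close>
  (\<open>cauchy_affine\<close>);

  \<^item> the polar map of a vector with a drift component has the full rank \<open>dim (L + N L) - dim L\<close>,
  while that of a vector in \<open>L\<close> has rank at most one (\<open>polar_rank_transversal\<close>,
  \<open>polar_rank_vertical\<close>). If the full rank is at least two, the singular lines are therefore those
  of \<open>L\<close>, and the resolvent bundle is the constant, hence integrable, space \<open>L\<close>.

  With \<open>L\<^sub>i\<close> spanned by the \<open>\<partial>/\<partial>z\<^sub>h\<^sup>l\<^sup>j\<close> with \<open>j \<le> h + i\<close> one has \<open>L\<^sub>i\<^sub>+\<^sub>1 = L\<^sub>i + N L\<^sub>i\<close>, and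
  \<open>dim L\<^sub>i - dim L\<^sub>i\<^sub>-\<^sub>1 = \<rho>\<^sub>i + \<dots> + \<rho>\<^sub>k\<close>; this gives the derived length \<open>k\<close> and the decceleration \<open>\<tau>\<close>.
  The bundles in the condition on \<open>dt\<close> lie in \<open>L\<^sub>k\<^sub>-\<^sub>1\<close>, which is orthogonal to \<open>e\<^sub>0\<close>, and a static
  feedback transformation preserves time.

  To carry this over to \<open>\<K>\<close>, no distribution is pushed forward. If \<open>\<theta>\<close> is the chart and \<open>J\<close> its
  derivative, a vector field \<open>X\<close> is represented by the vector valued function \<open>J X\<close> on the same
  domain. The symmetry of the second derivative of \<open>\<theta>\<close> yields \<open>J [X, Y] = D(J Y) X - D(J X) Y\<close>
  (\<open>J_lie_bracket\<close>), so the formula for brackets holds in every chart. The identity chart covers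
  the normal form itself, and the ranks of the two distributions agree because both are given by
  the same expressions in \<open>N\<close> and \<open>L\<^sub>i\<close>.
\<close>

section \<open>Calculus of smooth maps\<close>

text \<open>Derivatives at points of an open set only see the function on that set.\<close>

lemma Ck_on_cong:
  assumes "open U" "\<And>x. x \<in> U \<Longrightarrow> f x = g x" "Ck_on k U f"
  shows "Ck_on k U g"
  using assms(2,3)
proof (induction k arbitrary: f g)
  case 0
  then show ?case using continuous_on_cong[of U U f g] by simp
next
  case (Suc k)
  have d: "(g has_derivative frechet_derivative f (at x)) (at x)" if "x \<in> U" for x
  proof -
    have "(f has_derivative frechet_derivative f (at x)) (at x)"
      using Suc.prems(2) that by (simp add: frechet_derivative_works[symmetric])
    from has_derivative_transform_within_open[OF this assms(1) that] Suc.prems(1)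
    show ?thesis by blast
  qed
  have eq: "frechet_derivative g (at x) = frechet_derivative f (at x)" if "x \<in> U" for x
    using d[OF that] frechet_derivative_at by metis
  have "Ck_on k U (\<lambda>x. frechet_derivative g (at x) v)" for v
    by (rule Suc.IH[of "\<lambda>x. frechet_derivative f (at x) v"]) (use Suc.prems eq in simp_all)
  then show ?case using d unfolding Ck_on.simps differentiable_def by blast
qed

lemma Ck_on_imp_continuous_on: "Ck_on k U f \<Longrightarrow> continuous_on U f"
  by (cases k)
     (simp_all add: continuous_at_imp_continuous_on differentiable_imp_continuous_within)

lemma Ck_on_Suc_imp: "Ck_on (Suc k) U f \<Longrightarrow> Ck_on k U f"
proof (induction k arbitrary: f)
  case 0
  then show ?case using Ck_on_imp_continuous_on[OF 0] by simp
next
  case (Suc k)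
  have "Ck_on (Suc k) U (\<lambda>x. frechet_derivative f (at x) v)" for v
    using Suc.prems by simp
  with Suc.IH Suc.prems show ?case by auto
qed

text \<open>In this form the derivative may be given by any formula valid on \<open>U\<close>, which is how the
  closure properties below are proved by induction on the order.\<close>

lemma Ck_on_SucI:
  assumes "open U" "\<And>x. x \<in> U \<Longrightarrow> (f has_derivative D x) (at x)"
    and "\<And>v. Ck_on k U (\<lambda>x. D x v)"
  shows "Ck_on (Suc k) U f"
proof -
  have eq: "D x = frechet_derivative f (at x)" if "x \<in> U" for x
    using assms(2)[OF that] by (rule frechet_derivative_at)
  have "Ck_on k U (\<lambda>x. frechet_derivative f (at x) v)" for v
    by (rule Ck_on_cong[OF assms(1) _ assms(3)[of v]]) (simp add: eq)
  then show ?thesis using assms(2) unfolding Ck_on.simps differentiable_def by blast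
qed

lemma Ck_on_SucD:
  assumes "Ck_on (Suc k) U f"
  shows "x \<in> U \<Longrightarrow> (f has_derivative frechet_derivative f (at x)) (at x)"
    and "Ck_on k U (\<lambda>x. frechet_derivative f (at x) v)"
  using assms by (auto simp: frechet_derivative_works[symmetric])

lemma Ck_on_const: "Ck_on k U (\<lambda>x. c)"
  by (induction k arbitrary: c) auto

lemma Ck_on_bounded_linear:
  assumes "bounded_linear h" "open U" "Ck_on k U f"
  shows "Ck_on k U (\<lambda>x. h (f x))"
  using assms(3)
proof (induction k arbitrary: f)
  case 0
  then show ?case
    using assms(1) by (auto intro: bounded_linear.continuous_on)
next
  case (Suc k)
  show ?case
    by (rule Ck_on_SucI[OF assms(2), where D = "\<lambda>x v. h (frechet_derivative f (at x) v)"])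
       (use Suc Ck_on_SucD[OF Suc.prems] in
         \<open>auto intro: bounded_linear.has_derivative[OF assms(1)] simp del: Ck_on.simps\<close>)
qed

lemma Ck_on_linear:
  assumes "bounded_linear h" "open U"
  shows "Ck_on k U h"
proof (cases k)
  case 0
  then show ?thesis using assms by (simp add: linear_continuous_on)
next
  case (Suc n)
  show ?thesis unfolding Suc
    by (rule Ck_on_SucI[OF assms(2), where D = "\<lambda>x. h"])
       (auto simp: Ck_on_const bounded_linear_imp_has_derivative[OF assms(1)])
qed

lemma Ck_on_add:
  assumes "open U" "Ck_on k U f" "Ck_on k U g"
  shows "Ck_on k U (\<lambda>x. f x + g x)"
  using assms(2,3)
proof (induction k arbitrary: f g)
  case 0
  then show ?case by (auto intro: continuous_on_add)
next
  case (Suc k)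
  show ?case
    by (rule Ck_on_SucI[OF assms(1),
          where D = "\<lambda>x v. frechet_derivative f (at x) v + frechet_derivative g (at x) v"])
       (use Suc.IH Ck_on_SucD[OF Suc.prems(1)] Ck_on_SucD[OF Suc.prems(2)] in
         \<open>auto intro!: has_derivative_add\<close>)
qed

lemma Ck_on_bounded_bilinear:
  assumes "bounded_bilinear h" "open U" "Ck_on k U f" "Ck_on k U g"
  shows "Ck_on k U (\<lambda>x. h (f x) (g x))"
  using assms(3,4)
proof (induction k arbitrary: f g)
  case 0
  then show ?case
    using assms(1) by (auto intro: bounded_bilinear.continuous_on)
next
  case (Suc k)
  have "Ck_on k U (\<lambda>x. h (f x) (frechet_derivative g (at x) v) +
          h (frechet_derivative f (at x) v) (g x))" for v
    using Suc.prems
    by (intro Ck_on_add[OF assms(2)] Suc.IH Ck_on_SucD Ck_on_Suc_imp[of k U f]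
        Ck_on_Suc_imp[of k U g])
  then show ?case
    by (intro Ck_on_SucI[OF assms(2), where D = "\<lambda>x v. h (f x) (frechet_derivative g (at x) v) +
          h (frechet_derivative f (at x) v) (g x)"])
       (use Ck_on_SucD[OF Suc.prems(1)] Ck_on_SucD[OF Suc.prems(2)] in
         \<open>auto intro: bounded_bilinear.FDERIV[OF assms(1)]\<close>)
qed

lemma Ck_on_sum:
  assumes "open U" "\<And>i. i \<in> I \<Longrightarrow> Ck_on k U (f i)"
  shows "Ck_on k U (\<lambda>x. \<Sum>i\<in>I. f i x)"
  using assms(2)
  by (induction I rule: infinite_finite_induct) (auto simp: Ck_on_const intro: Ck_on_add[OF assms(1)])

text \<open>Expanding the direction in an orthonormal basis turns the chain rule into a sum of
  products, so that each order of differentiability of a composition follows from the previous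
  one.\<close>

lemma linear_expand_Basis:
  fixes h :: "'a::euclidean_space \<Rightarrow> 'b::real_vector"
  assumes "linear h"
  shows "h w = (\<Sum>b\<in>Basis. (w \<bullet> b) *\<^sub>R h b)"
proof -
  have "h w = h (\<Sum>b\<in>Basis. (w \<bullet> b) *\<^sub>R b)" by (simp add: euclidean_representation)
  also have "\<dots> = (\<Sum>b\<in>Basis. (w \<bullet> b) *\<^sub>R h b)"
    using assms by (simp add: linear_sum linear_scale)
  finally show ?thesis .
qed

lemma Ck_on_compose:
  fixes f :: "'a::real_normed_vector \<Rightarrow> 'b::euclidean_space"
    and g :: "'b \<Rightarrow> 'c::real_normed_vector"
  assumes "open U" "Ck_on k U f" "Ck_on k V g" "f ` U \<subseteq> V"
  shows "Ck_on k U (\<lambda>x. g (f x))"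
  using assms(2,3)
proof (induction k arbitrary: g)
  case 0
  then show ?case using assms(4) continuous_on_compose2 by auto
next
  case (Suc k)
  let ?D = "\<lambda>x v. \<Sum>b\<in>Basis. (frechet_derivative f (at x) v \<bullet> b) *\<^sub>R frechet_derivative g (at (f x)) b"
  have "(\<lambda>v. frechet_derivative g (at (f x)) (frechet_derivative f (at x) v)) = ?D x"
    if "x \<in> U" for x
  proof
    fix v
    have "linear (frechet_derivative g (at (f x)))"
      using Suc.prems(2) assms(4) that by (auto intro!: linear_frechet_derivative)
    then show "frechet_derivative g (at (f x)) (frechet_derivative f (at x) v) = ?D x v"
      by (rule linear_expand_Basis)
  qed
  moreover have "((\<lambda>x. g (f x)) has_derivative
      (\<lambda>v. frechet_derivative g (at (f x)) (frechet_derivative f (at x) v))) (at x)"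
    if "x \<in> U" for x
    using Ck_on_SucD(1)[OF Suc.prems(1) that] Ck_on_SucD(1)[OF Suc.prems(2), of "f x"]
      assms(4) that by (auto intro: has_derivative_compose)
  ultimately have 1: "((\<lambda>x. g (f x)) has_derivative ?D x) (at x)" if "x \<in> U" for x
    using that by auto
  have 2: "Ck_on k U (\<lambda>x. ?D x v)" for v
    using Suc.prems
    by (intro Ck_on_sum Ck_on_bounded_bilinear[OF bounded_bilinear_scaleR] assms(1)
        Ck_on_bounded_bilinear[OF bounded_bilinear_inner] Ck_on_SucD Ck_on_const
        Suc.IH Ck_on_Suc_imp[of k U f])
  show ?case by (rule Ck_on_SucI[OF assms(1) 1 2])
qed

lemma smooth_on_cong:
  "open U \<Longrightarrow> (\<And>x. x \<in> U \<Longrightarrow> f x = g x) \<Longrightarrow> smooth_on U f \<Longrightarrow> smooth_on U g"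
  unfolding smooth_on_def by (metis Ck_on_cong)

lemma smooth_on_has_derivative:
  "smooth_on U f \<Longrightarrow> x \<in> U \<Longrightarrow> (f has_derivative frechet_derivative f (at x)) (at x)"
  unfolding smooth_on_def using Ck_on_SucD(1) by blast

lemma smooth_on_frechet_derivative:
  "smooth_on U f \<Longrightarrow> smooth_on U (\<lambda>x. frechet_derivative f (at x) v)"
  unfolding smooth_on_def using Ck_on_SucD(2) by blast

lemma smooth_on_const: "smooth_on U (\<lambda>x. c)"
  by (simp add: smooth_on_def Ck_on_const)

lemma smooth_on_add:
  "open U \<Longrightarrow> smooth_on U f \<Longrightarrow> smooth_on U g \<Longrightarrow> smooth_on U (\<lambda>x. f x + g x)"
  by (simp add: smooth_on_def Ck_on_add)

lemma smooth_on_sum: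
  "open U \<Longrightarrow> (\<And>i. i \<in> I \<Longrightarrow> smooth_on U (f i)) \<Longrightarrow> smooth_on U (\<lambda>x. \<Sum>i\<in>I. f i x)"
  by (simp add: smooth_on_def Ck_on_sum)

lemma smooth_on_scaleR:
  "open U \<Longrightarrow> smooth_on U f \<Longrightarrow> smooth_on U g \<Longrightarrow> smooth_on U (\<lambda>x. f x *\<^sub>R g x)"
  by (simp add: smooth_on_def Ck_on_bounded_bilinear[OF bounded_bilinear_scaleR])

lemma smooth_on_inner:
  "open U \<Longrightarrow> smooth_on U f \<Longrightarrow> smooth_on U g \<Longrightarrow> smooth_on U (\<lambda>x. f x \<bullet> g x)"
  by (simp add: smooth_on_def Ck_on_bounded_bilinear[OF bounded_bilinear_inner])

lemma smooth_on_linear: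
  fixes h :: "'a::euclidean_space \<Rightarrow> 'b::real_normed_vector"
  shows "linear h \<Longrightarrow> open U \<Longrightarrow> smooth_on U f \<Longrightarrow> smooth_on U (\<lambda>x. h (f x))"
  unfolding smooth_on_def linear_conv_bounded_linear using Ck_on_bounded_linear by blast

lemma smooth_on_ident: "open U \<Longrightarrow> smooth_on U (\<lambda>x. x)"
  unfolding smooth_on_def using Ck_on_linear[OF bounded_linear_ident] by blast

lemma smooth_on_diff:
  fixes f g :: "'a::real_normed_vector \<Rightarrow> 'b::euclidean_space"
  shows "open U \<Longrightarrow> smooth_on U f \<Longrightarrow> smooth_on U g \<Longrightarrow> smooth_on U (\<lambda>x. f x - g x)"
  using smooth_on_add[of U f "\<lambda>x. - g x"] smooth_on_linear[OF linear_uminus, of U g] by simp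

lemma smooth_on_compose:
  fixes f :: "'a::real_normed_vector \<Rightarrow> 'b::euclidean_space"
  shows "open U \<Longrightarrow> smooth_on U f \<Longrightarrow> smooth_on V g \<Longrightarrow> f ` U \<subseteq> V \<Longrightarrow> smooth_on U (\<lambda>x. g (f x))"
  unfolding smooth_on_def using Ck_on_compose by blast

lemma smooth_on_linear_family:
  fixes Z :: "'a::real_normed_vector \<Rightarrow> 'b::euclidean_space"
    and A :: "'a \<Rightarrow> 'b \<Rightarrow> 'c::real_normed_vector"
  assumes "open U" "\<And>x. x \<in> U \<Longrightarrow> linear (A x)" "\<And>v. smooth_on U (\<lambda>x. A x v)" "smooth_on U Z"
  shows "smooth_on U (\<lambda>x. A x (Z x))"
proof (rule smooth_on_cong[OF assms(1)])
  show "smooth_on U (\<lambda>x. \<Sum>b\<in>Basis. (Z x \<bullet> b) *\<^sub>R A x b)"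
    by (intro smooth_on_sum smooth_on_scaleR smooth_on_inner smooth_on_const assms)
  show "(\<Sum>b\<in>Basis. (Z x \<bullet> b) *\<^sub>R A x b) = A x (Z x)" if "x \<in> U" for x
    by (rule linear_expand_Basis[OF assms(2)[OF that], symmetric])
qed

lemma smooth_on_derivative_along:
  fixes f :: "'a::euclidean_space \<Rightarrow> 'b::real_normed_vector"
  assumes "open U" "smooth_on U f" "smooth_on U Z"
  shows "smooth_on U (\<lambda>x. frechet_derivative f (at x) (Z x))"
  by (rule smooth_on_linear_family[OF assms(1) _ _ assms(3)])
     (use assms(2) in \<open>blast intro: has_derivative_linear smooth_on_has_derivative
        smooth_on_frechet_derivative\<close>)+


section \<open>Symmetry of second derivatives\<close>

lemma mvt_segment:
  fixes g :: "'a::real_normed_vector \<Rightarrow> real"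
  assumes "s > 0"
    and "\<And>t. 0 \<le> t \<Longrightarrow> t \<le> s \<Longrightarrow> (g has_derivative D (x + t *\<^sub>R v)) (at (x + t *\<^sub>R v))"
  shows "\<exists>t. 0 < t \<and> t < s \<and> g (x + s *\<^sub>R v) - g x = s * D (x + t *\<^sub>R v) v"
proof -
  have "((\<lambda>t. g (x + t *\<^sub>R v)) has_derivative (\<lambda>r. r * D (x + t *\<^sub>R v) v)) (at t)"
    if t: "0 \<le> t" "t \<le> s" for t
  proof -
    have "((\<lambda>t. x + t *\<^sub>R v) has_derivative (\<lambda>r. r *\<^sub>R v)) (at t)"
      by (auto intro!: derivative_eq_intros)
    from has_derivative_compose[OF this assms(2)[OF t]]
    have "((\<lambda>t. g (x + t *\<^sub>R v)) has_derivative (\<lambda>r. D (x + t *\<^sub>R v) (r *\<^sub>R v))) (at t)" .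
    moreover have "D (x + t *\<^sub>R v) (r *\<^sub>R v) = r * D (x + t *\<^sub>R v) v" for r
      using linear_scale[OF has_derivative_linear[OF assms(2)[OF t]]] by simp
    ultimately show ?thesis by simp
  qed
  from mvt_simple[OF assms(1), of "\<lambda>t. g (x + t *\<^sub>R v)", OF has_derivative_at_withinI[OF this]]
  show ?thesis by auto
qed

text \<open>Two applications of the mean value theorem: first in direction \<open>v\<close> to the difference
  \<open>y \<mapsto> g (y + s w) - g y\<close>, then in direction \<open>w\<close> to the directional derivative along \<open>v\<close>.\<close>

lemma second_difference_mvt:
  fixes g :: "'a::real_normed_vector \<Rightarrow> real"
  assumes "s > 0" "Ck_on 2 U g"
    and "\<And>r t. 0 \<le> r \<Longrightarrow> r \<le> s \<Longrightarrow> 0 \<le> t \<Longrightarrow> t \<le> s \<Longrightarrow> x + r *\<^sub>R v + t *\<^sub>R w \<in> U"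
  shows "\<exists>r t. 0 < r \<and> r < s \<and> 0 < t \<and> t < s \<and>
     g (x + s *\<^sub>R v + s *\<^sub>R w) - g (x + s *\<^sub>R v) - g (x + s *\<^sub>R w) + g x =
       s * (s * frechet_derivative (\<lambda>y. frechet_derivative g (at y) v)
         (at (x + r *\<^sub>R v + t *\<^sub>R w)) w)"
proof -
  let ?D = "\<lambda>y. frechet_derivative g (at y)"
  have C: "Ck_on (Suc 1) U g" using assms(2) by (simp add: numeral_2_eq_2)
  note d = Ck_on_SucD(1)[OF C]
  have C1: "Ck_on (Suc 0) U (\<lambda>y. ?D y v)" using Ck_on_SucD(2)[OF C] by simp
  have "((\<lambda>y. g (y + s *\<^sub>R w) - g y) has_derivative (\<lambda>u. ?D (x + r *\<^sub>R v + s *\<^sub>R w) u - ?D (x + r *\<^sub>R v) u))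
          (at (x + r *\<^sub>R v))"
    if "0 \<le> r" "r \<le> s" for r
  proof -
    have "x + r *\<^sub>R v + s *\<^sub>R w \<in> U" "x + r *\<^sub>R v \<in> U"
      using assms(1) assms(3)[of r s] assms(3)[of r 0] that by auto
    note e = d[OF this(1)] d[OF this(2)]
    have "((\<lambda>y. y + s *\<^sub>R w) has_derivative (\<lambda>u. u)) (at (x + r *\<^sub>R v))"
      by (auto intro!: derivative_eq_intros)
    from has_derivative_compose[OF this, of g] e
    show ?thesis by (intro has_derivative_diff) auto
  qed
  from mvt_segment[OF assms(1), of "\<lambda>y. g (y + s *\<^sub>R w) - g y"
      "\<lambda>y u. ?D (y + s *\<^sub>R w) u - ?D y u" x v, OF this]
  obtain r where r: "0 < r" "r < s"
    "g (x + s *\<^sub>R v + s *\<^sub>R w) - g (x + s *\<^sub>R v) - (g (x + s *\<^sub>R w) - g x) =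
       s * (?D (x + r *\<^sub>R v + s *\<^sub>R w) v - ?D (x + r *\<^sub>R v) v)" by blast
  from mvt_segment[OF assms(1), of "\<lambda>y. ?D y v" "\<lambda>y. frechet_derivative (\<lambda>y. ?D y v) (at y)"
      "x + r *\<^sub>R v" w, OF Ck_on_SucD(1)[OF C1 assms(3)]] r
  obtain t where "0 < t" "t < s"
    "?D (x + r *\<^sub>R v + s *\<^sub>R w) v - ?D (x + r *\<^sub>R v) v =
      s * frechet_derivative (\<lambda>y. ?D y v) (at (x + r *\<^sub>R v + t *\<^sub>R w)) w" by auto
  with r show ?thesis by (intro exI[of _ r] exI[of _ t]) simp
qed

text \<open>The second difference of \<open>g\<close> over a small parallelogram is symmetric in its two sides, and
  by the mean value theorem it equals, up to the factor \<open>s\<^sup>2\<close>, either mixed derivative at some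
  point of the parallelogram; shrinking the parallelogram identifies the two.\<close>

lemma symmetric_second_derivative_real:
  fixes g :: "'a::real_normed_vector \<Rightarrow> real"
  assumes "open U" "x \<in> U" "Ck_on 2 U g"
  shows "frechet_derivative (\<lambda>y. frechet_derivative g (at y) v) (at x) w =
         frechet_derivative (\<lambda>y. frechet_derivative g (at y) w) (at x) v"
proof -
  let ?H = "\<lambda>v w y. frechet_derivative (\<lambda>y. frechet_derivative g (at y) v) (at y) w"
  have cont: "isCont (?H v w) x" for v w
    using assms continuous_on_eq_continuous_at[OF assms(1), of "?H v w"]
    by (simp add: numeral_2_eq_2)
  have "\<bar>?H v w x - ?H w v x\<bar> \<le> e" if e: "e > 0" for e
  proof -
    obtain d1 where d1: "d1 > 0" "\<And>y. dist y x < d1 \<Longrightarrow> dist (?H v w y) (?H v w x) < e/2"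
      using cont[of v w, unfolded continuous_at_eps_delta, rule_format, of "e/2"] e
      by auto
    obtain d2 where d2: "d2 > 0" "\<And>y. dist y x < d2 \<Longrightarrow> dist (?H w v y) (?H w v x) < e/2"
      using cont[of w v, unfolded continuous_at_eps_delta, rule_format, of "e/2"] e
      by auto
    obtain d3 where d3: "d3 > 0" "ball x d3 \<subseteq> U"
      using assms openE by blast
    define d where "d = min d1 (min d2 d3)"
    define s where "s = d / (2 * (norm v + norm w + 1))"
    have n: "norm v + norm w + 1 > 0" by (smt (verit) norm_ge_zero)
    have d: "d > 0" and s: "s > 0" using d1 d2 d3 n by (auto simp: d_def s_def)
    have near: "dist (x + r *\<^sub>R a + t *\<^sub>R b) x < d"
      if "0 \<le> r" "r \<le> s" "0 \<le> t" "t \<le> s" "norm a + norm b = norm v + norm w" for r t a b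
    proof -
      have "dist (x + r *\<^sub>R a + t *\<^sub>R b) x = norm (r *\<^sub>R a + t *\<^sub>R b)"
        by (simp add: dist_norm)
      also have "\<dots> \<le> r * norm a + t * norm b"
        using norm_triangle_ineq[of "r *\<^sub>R a" "t *\<^sub>R b"] that by simp
      also have "\<dots> \<le> s * norm a + s * norm b"
        using that by (intro add_mono mult_right_mono) auto
      also have "\<dots> = s * (norm v + norm w)" using that by (simp add: distrib_left[symmetric])
      also have "\<dots> < s * (2 * (norm v + norm w + 1))"
        using s by (smt (verit) norm_ge_zero mult_strict_left_mono)
      also have "\<dots> = d" using n by (simp add: s_def)
      finally show ?thesis .
    qed
    have inU: "x + r *\<^sub>R a + t *\<^sub>R b \<in> U"
      if "0 \<le> r" "r \<le> s" "0 \<le> t" "t \<le> s" "norm a + norm b = norm v + norm w" for r t a b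
      using near[OF that] d3 by (auto simp: d_def dist_commute subset_iff)
    obtain r t where rt: "0 < r" "r < s" "0 < t" "t < s"
      "g (x + s *\<^sub>R v + s *\<^sub>R w) - g (x + s *\<^sub>R v) - g (x + s *\<^sub>R w) + g x =
         s * (s * ?H v w (x + r *\<^sub>R v + t *\<^sub>R w))"
      using second_difference_mvt[OF s assms(3), of x v w] inU by auto
    obtain r' t' where rt': "0 < r'" "r' < s" "0 < t'" "t' < s"
      "g (x + s *\<^sub>R w + s *\<^sub>R v) - g (x + s *\<^sub>R w) - g (x + s *\<^sub>R v) + g x =
         s * (s * ?H w v (x + r' *\<^sub>R w + t' *\<^sub>R v))"
      using second_difference_mvt[OF s assms(3), of x w v] inU by (auto simp: add.commute)
    have comm: "x + s *\<^sub>R w + s *\<^sub>R v = x + s *\<^sub>R v + s *\<^sub>R w" by simp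
    have "s * (s * ?H v w (x + r *\<^sub>R v + t *\<^sub>R w)) = s * (s * ?H w v (x + r' *\<^sub>R w + t' *\<^sub>R v))"
      using rt(5) rt'(5) unfolding comm by linarith
    then have eq: "?H v w (x + r *\<^sub>R v + t *\<^sub>R w) = ?H w v (x + r' *\<^sub>R w + t' *\<^sub>R v)"
      using s by simp
    have "dist (x + r *\<^sub>R v + t *\<^sub>R w) x < d1" "dist (x + r' *\<^sub>R w + t' *\<^sub>R v) x < d2"
      using near[of r t v w] near[of r' t' w v] rt rt' by (auto simp: d_def)
    from d1(2)[OF this(1)] d2(2)[OF this(2)] eq show ?thesis
      unfolding dist_real_def by argo
  qed
  then have "\<bar>?H v w x - ?H w v x\<bar> \<le> 0" by (rule field_le_epsilon) (simp only: add_0)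
  then show ?thesis by simp
qed

lemma symmetric_second_derivative:
  fixes f :: "'a::real_normed_vector \<Rightarrow> 'b::euclidean_space"
  assumes "open U" "x \<in> U" "smooth_on U f"
  shows "frechet_derivative (\<lambda>y. frechet_derivative f (at y) v) (at x) w =
         frechet_derivative (\<lambda>y. frechet_derivative f (at y) w) (at x) v"
proof (rule euclidean_eqI)
  fix b :: 'b
  let ?g = "\<lambda>y. f y \<bullet> b"
  have C: "Ck_on 2 U ?g"
    using smooth_on_inner[OF assms(1,3) smooth_on_const] by (simp add: smooth_on_def)
  have comp: "frechet_derivative (\<lambda>y. h y \<bullet> b) (at y) w = frechet_derivative h (at y) w \<bullet> b"
    if "smooth_on U h" "y \<in> U" for h :: "'a \<Rightarrow> 'b" and y w
    using frechet_derivative_at[OF has_derivative_inner_left[OF smooth_on_has_derivative[OF that]]]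
    by metis
  have H: "frechet_derivative (\<lambda>y. frechet_derivative ?g (at y) v) (at x) w =
        frechet_derivative (\<lambda>y. frechet_derivative f (at y) v) (at x) w \<bullet> b" for v w
  proof -
    have "frechet_derivative (\<lambda>y. frechet_derivative ?g (at y) v) (at x) =
          frechet_derivative (\<lambda>y. frechet_derivative f (at y) v \<bullet> b) (at x)"
    proof (rule frechet_derivative_transform_within_open[symmetric])
      show "(\<lambda>y. frechet_derivative f (at y) v \<bullet> b) differentiable at x"
        using smooth_on_has_derivative[OF
            smooth_on_inner[OF assms(1) smooth_on_frechet_derivative[OF assms(3)] smooth_on_const]
            assms(2)] by (auto simp: differentiable_def)
    qed (use assms comp in auto)
    then show ?thesis
      using comp[OF smooth_on_frechet_derivative[OF assms(3)] assms(2)] by simp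
  qed
  show "frechet_derivative (\<lambda>y. frechet_derivative f (at y) v) (at x) w \<bullet> b =
        frechet_derivative (\<lambda>y. frechet_derivative f (at y) w) (at x) v \<bullet> b"
    using symmetric_second_derivative_real[OF assms(1,2) C, of v w] H by simp
qed


section \<open>Derivatives of linear families, and bases\<close>

text \<open>Testing against the orthogonal complement of \<open>L\<close> reduces this to the derivative of the
  zero function.\<close>

lemma derivative_in_subspace:
  fixes b :: "'a::euclidean_space \<Rightarrow> 'b::euclidean_space"
  assumes "open U" "p \<in> U" "subspace L" "\<And>q. q \<in> U \<Longrightarrow> b q \<in> L"
    and "(b has_derivative b') (at p)"
  shows "b' v \<in> L"
proof -
  have "b' v \<bullet> y = 0" if "y \<in> L\<^sup>\<bottom>" for y
  proof -
    have "((\<lambda>q. b q \<bullet> y) has_derivative (\<lambda>v. b' v \<bullet> y)) (at p)"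
      by (rule has_derivative_inner_left[OF assms(5)])
    moreover have "b q \<bullet> y = 0" if "q \<in> U" for q
      using \<open>y \<in> L\<^sup>\<bottom>\<close> assms(4)[OF that]
      by (auto simp: orthogonal_comp_def orthogonal_def inner_commute)
    ultimately have "((\<lambda>q. 0) has_derivative (\<lambda>v. b' v \<bullet> y)) (at p)"
      using has_derivative_transform_within_open[OF _ assms(1,2)] by fastforce
    from has_derivative_unique[OF this has_derivative_const] show ?thesis by metis
  qed
  then have "b' v \<in> L\<^sup>\<bottom>\<^sup>\<bottom>"
    by (auto simp: orthogonal_comp_def orthogonal_def inner_commute)
  then show ?thesis using orthogonal_comp_self[OF assms(3)] by simp
qed

text \<open>The product rule for \<open>x \<mapsto> A x (Z x)\<close>, obtained by expanding \<open>Z x\<close> in an orthonormal basis.\<close>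

lemma linear_family_has_derivative:
  fixes Z :: "'a::real_normed_vector \<Rightarrow> 'b::euclidean_space"
    and A :: "'a \<Rightarrow> 'b \<Rightarrow> 'c::real_normed_vector"
  assumes "open U" "p \<in> U" "\<And>x. x \<in> U \<Longrightarrow> linear (A x)" "\<And>v. smooth_on U (\<lambda>x. A x v)"
    and "smooth_on U Z"
  shows "((\<lambda>x. A x (Z x)) has_derivative (\<lambda>v. A p (frechet_derivative Z (at p) v) +
           frechet_derivative (\<lambda>x. A x (Z p)) (at p) v)) (at p)"
proof -
  let ?A = "\<lambda>b. frechet_derivative (\<lambda>x. A x b) (at p)"
  have expand: "A x w = (\<Sum>b\<in>Basis. (w \<bullet> b) *\<^sub>R A x b)" if "x \<in> U" for x w
    by (rule linear_expand_Basis[OF assms(3)[OF that]])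
  have dA: "((\<lambda>x. A x b) has_derivative ?A b) (at p)" for b
    by (rule smooth_on_has_derivative[OF assms(4,2)])
  have dZ: "(Z has_derivative frechet_derivative Z (at p)) (at p)"
    by (rule smooth_on_has_derivative[OF assms(5,2)])
  have "((\<lambda>x. \<Sum>b\<in>Basis. (Z p \<bullet> b) *\<^sub>R A x b) has_derivative
          (\<lambda>v. \<Sum>b\<in>Basis. (Z p \<bullet> b) *\<^sub>R ?A b v)) (at p)"
    by (intro has_derivative_sum has_derivative_scaleR_right dA)
  then have "((\<lambda>x. A x (Z p)) has_derivative (\<lambda>v. \<Sum>b\<in>Basis. (Z p \<bullet> b) *\<^sub>R ?A b v)) (at p)"
    by (rule has_derivative_transform_within_open[OF _ assms(1,2)]) (simp only: expand[of _ "Z p"])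
  then have c: "?A (Z p) = (\<lambda>v. \<Sum>b\<in>Basis. (Z p \<bullet> b) *\<^sub>R ?A b v)"
    by (rule frechet_derivative_at[symmetric])
  have "((\<lambda>x. \<Sum>b\<in>Basis. (Z x \<bullet> b) *\<^sub>R A x b) has_derivative
      (\<lambda>v. \<Sum>b\<in>Basis. (Z p \<bullet> b) *\<^sub>R ?A b v + (frechet_derivative Z (at p) v \<bullet> b) *\<^sub>R A p b)) (at p)"
    by (intro has_derivative_sum has_derivative_scaleR dA has_derivative_inner_left dZ)
  then have "((\<lambda>x. A x (Z x)) has_derivative
      (\<lambda>v. \<Sum>b\<in>Basis. (Z p \<bullet> b) *\<^sub>R ?A b v + (frechet_derivative Z (at p) v \<bullet> b) *\<^sub>R A p b)) (at p)"
    by (rule has_derivative_transform_within_open[OF _ assms(1,2)]) (rule expand[symmetric])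
  moreover have "(\<Sum>b\<in>Basis. (Z p \<bullet> b) *\<^sub>R ?A b v + (frechet_derivative Z (at p) v \<bullet> b) *\<^sub>R A p b)
     = A p (frechet_derivative Z (at p) v) + ?A (Z p) v" for v
    unfolding c expand[OF assms(2), of "frechet_derivative Z (at p) v"]
    by (simp add: sum.distrib)
  ultimately show ?thesis by simp
qed

lemma basis_enumeration:
  fixes L :: "'a::euclidean_space set"
  assumes "subspace L"
  obtains g :: "nat \<Rightarrow> 'a" where "span (g ` {..<dim L}) = L" "\<And>i. i < dim L \<Longrightarrow> g i \<in> L"
proof -
  obtain B where B: "B \<subseteq> L" "independent B" "L \<subseteq> span B" "card B = dim L"
    using basis_exists by blast
  have "finite B" using B(2) by (rule independent_imp_finite)
  then obtain g where g: "bij_betw g {0..<card B} B"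
    using ex_bij_betw_nat_finite by blast
  have im: "g ` {..<dim L} = B"
    using g B(4) by (auto simp: bij_betw_def lessThan_atLeast0)
  have "span B = L"
    using B(1,3) assms by (simp add: span_subspace)
  with im B(1) that[of g] show ?thesis by auto
qed


section \<open>Vector fields seen through a chart\<close>

locale flat_chart =
  fixes U :: "'a::euclidean_space set" and \<theta> :: "'a \<Rightarrow> 'a"
  assumes chart: "diffeo_on U \<theta>"
begin

definition J :: "'a \<Rightarrow> 'a \<Rightarrow> 'a" where
  "J p = frechet_derivative \<theta> (at p)"

definition Ji :: "'a \<Rightarrow> 'a \<Rightarrow> 'a" where
  "Ji p = frechet_derivative (the_inv_into U \<theta>) (at (\<theta> p))"

lemma open_U: "open U" and smooth_chart: "smooth_on U \<theta>" and inj_chart: "inj_on \<theta> U"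
  and open_image: "open (\<theta> ` U)" and smooth_inverse: "smooth_on (\<theta> ` U) (the_inv_into U \<theta>)"
  using chart by (auto simp: diffeo_on_def)

lemma has_derivative_chart: "p \<in> U \<Longrightarrow> (\<theta> has_derivative J p) (at p)"
  unfolding J_def by (rule smooth_on_has_derivative[OF smooth_chart])

lemma has_derivative_inverse:
  "p \<in> U \<Longrightarrow> (the_inv_into U \<theta> has_derivative Ji p) (at (\<theta> p))"
  unfolding Ji_def by (rule smooth_on_has_derivative[OF smooth_inverse]) simp

lemma linear_J: "p \<in> U \<Longrightarrow> linear (J p)"
  by (rule has_derivative_linear[OF has_derivative_chart])

lemma linear_Ji: "p \<in> U \<Longrightarrow> linear (Ji p)"
  by (rule has_derivative_linear[OF has_derivative_inverse])

lemma Ji_J: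
  assumes "p \<in> U"
  shows "Ji p (J p v) = v"
proof -
  have "((\<lambda>q. the_inv_into U \<theta> (\<theta> q)) has_derivative (\<lambda>v. Ji p (J p v))) (at p)"
    by (rule has_derivative_compose[OF has_derivative_chart has_derivative_inverse]) (use assms in auto)
  then have "((\<lambda>q. q) has_derivative (\<lambda>v. Ji p (J p v))) (at p)"
    by (rule has_derivative_transform_within_open[OF _ open_U assms])
       (simp add: the_inv_into_f_f[OF inj_chart])
  from has_derivative_unique[OF this has_derivative_ident] show ?thesis by metis
qed

lemma J_Ji:
  assumes "p \<in> U"
  shows "J p (Ji p v) = v"
proof -
  have "the_inv_into U \<theta> (\<theta> p) = p" using assms by (simp add: the_inv_into_f_f[OF inj_chart])
  then have "((\<lambda>y. \<theta> (the_inv_into U \<theta> y)) has_derivative (\<lambda>v. J p (Ji p v))) (at (\<theta> p))"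
    using has_derivative_compose[OF has_derivative_inverse[OF assms], of \<theta> "J p"]
      has_derivative_chart[OF assms] by simp
  then have "((\<lambda>q. q) has_derivative (\<lambda>v. J p (Ji p v))) (at (\<theta> p))"
    by (rule has_derivative_transform_within_open[OF _ open_image])
       (use assms in \<open>auto simp: f_the_inv_into_f[OF inj_chart]\<close>)
  from has_derivative_unique[OF this has_derivative_ident] show ?thesis by metis
qed

lemma smooth_J: "smooth_on U X \<Longrightarrow> smooth_on U (\<lambda>p. J p (X p))"
  unfolding J_def by (rule smooth_on_derivative_along[OF open_U smooth_chart])

lemma smooth_Ji:
  assumes "smooth_on U Z"
  shows "smooth_on U (\<lambda>p. Ji p (Z p))"
proof (rule smooth_on_linear_family[OF open_U linear_Ji _ assms])
  show "smooth_on U (\<lambda>p. Ji p v)" for v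
    unfolding Ji_def
    by (rule smooth_on_compose[OF open_U smooth_chart
          smooth_on_frechet_derivative[OF smooth_inverse] subset_refl])
qed

lemma preimage_J: "p \<in> U \<Longrightarrow> {v. J p v \<in> S} = Ji p ` S"
  by (force simp: J_Ji Ji_J image_iff)

lemma image_J_preimage: "p \<in> U \<Longrightarrow> J p ` {v. J p v \<in> S} = S"
  by (simp add: preimage_J image_image J_Ji)

lemma subspace_preimage_J: "p \<in> U \<Longrightarrow> subspace S \<Longrightarrow> subspace {v. J p v \<in> S}"
  unfolding preimage_J by (rule linear_subspace_image[OF linear_Ji])

lemma dim_preimage_J:
  assumes "p \<in> U"
  shows "dim {v. J p v \<in> S} = dim S"
  unfolding preimage_J[OF assms]
  by (rule dim_image_eq[OF linear_Ji[OF assms]]) (metis assms J_Ji inj_onI)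

lemma sub_bundle_preimage:
  assumes "\<And>i. i < r \<Longrightarrow> smooth_on U (Z i)"
    and "\<And>q. q \<in> U \<Longrightarrow> V q = {v. J q v \<in> span ((\<lambda>i. Z i q) ` {..<r})}"
    and "\<And>q. q \<in> U \<Longrightarrow> dim (span ((\<lambda>i. Z i q) ` {..<r})) = r"
  shows "sub_bundle U r V"
  unfolding sub_bundle_def
proof
  fix p assume p: "p \<in> U"
  have "V q = span ((\<lambda>i. Ji q (Z i q)) ` {..<r})" if q: "q \<in> U" for q
    using assms(2)[OF q] linear_span_image[OF linear_Ji[OF q], of "(\<lambda>i. Z i q) ` {..<r}"]
    by (simp add: preimage_J[OF q] image_image)
  moreover have "dim (V q) = r" if q: "q \<in> U" for q
    unfolding assms(2)[OF q] dim_preimage_J[OF q] by (rule assms(3)[OF q])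
  ultimately show "\<exists>S. open S \<and> p \<in> S \<and> S \<subseteq> U \<and>
        (\<exists>X::nat \<Rightarrow> 'a \<Rightarrow> 'a. (\<forall>i<r. smooth_on S (X i)) \<and>
           (\<forall>q\<in>S. V q = span ((\<lambda>i. X i q) ` {..<r}) \<and> dim (V q) = r))"
    using p open_U assms(1) smooth_Ji
    by (intro exI[of _ U] conjI exI[of _ "\<lambda>i q. Ji q (Z i q)"]) auto
qed

text \<open>Differentiating \<open>J Y\<close> along \<open>X\<close> gives \<open>J (DY X)\<close> plus the second derivative of \<open>\<theta>\<close> in the
  directions \<open>X\<close> and \<open>Y\<close>. The second derivative is symmetric and drops out of the difference.\<close>

lemma J_lie_bracket:
  assumes "smooth_on U X" "smooth_on U Y" "p \<in> U"
  shows "J p (lie_bracket X Y p) =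
    frechet_derivative (\<lambda>q. J q (Y q)) (at p) (X p) - frechet_derivative (\<lambda>q. J q (X q)) (at p) (Y p)"
proof -
  have D: "frechet_derivative (\<lambda>q. J q (Z q)) (at p) =
      (\<lambda>v. J p (frechet_derivative Z (at p) v) + frechet_derivative (\<lambda>q. J q (Z p)) (at p) v)"
    if "smooth_on U Z" for Z
    by (rule frechet_derivative_at[symmetric],
        rule linear_family_has_derivative[OF open_U assms(3) linear_J _ that])
       (use smooth_J[OF smooth_on_const] in auto)
  have "frechet_derivative (\<lambda>q. J q (Y p)) (at p) (X p) = frechet_derivative (\<lambda>q. J q (X p)) (at p) (Y p)"
    unfolding J_def by (rule symmetric_second_derivative[OF open_U assms(3) smooth_chart])
  then show ?thesis
    unfolding D[OF assms(1)] D[OF assms(2)] lie_bracket_def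
    by (simp add: linear_diff[OF linear_J[OF assms(3)]])
qed

lemma integrable_preimage:
  assumes "subspace L" "\<And>q. q \<in> U \<Longrightarrow> V q = {v. J q v \<in> L}"
  shows "integrable_distrib U V"
  unfolding integrable_distrib_def
proof
  fix p assume p: "p \<in> U"
  have "frechet_derivative \<theta> (at q) ` V q = L" if "q \<in> U" for q
    using image_J_preimage[OF that] assms(2)[OF that] by (simp add: J_def)
  then show "\<exists>S (\<phi>::'a \<Rightarrow> 'a) L. p \<in> S \<and> S \<subseteq> U \<and> diffeo_on S \<phi> \<and> subspace L \<and>
        (\<forall>q\<in>S. frechet_derivative \<phi> (at q) ` V q = L)"
    using p chart assms(1) by (intro exI[of _ U] exI[of _ \<theta>] exI[of _ L]) auto
qed

lemma sub_bundle_constant: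
  assumes "subspace L" "\<And>q. q \<in> U \<Longrightarrow> V q = {v. J q v \<in> L}"
  shows "sub_bundle U (dim L) V"
proof -
  obtain g :: "nat \<Rightarrow> 'a" where g: "span (g ` {..<dim L}) = L"
    using basis_enumeration[OF assms(1)] by metis
  show ?thesis
    by (rule sub_bundle_preimage[where Z = "\<lambda>i q. g i"]) (auto simp: g assms(2) smooth_on_const)
qed

end


section \<open>Linear control systems in a chart\<close>

text \<open>The vector \<open>e0\<close> is the time direction. As the range of \<open>N\<close> and all spaces \<open>L\<close> of directions
  are orthogonal to it, the coefficient of the drift in a tangent vector \<open>v\<close> is the inner product
  of \<open>J p v\<close> with \<open>e0\<close>, which depends smoothly on \<open>v\<close>; no frame has to be chosen.\<close>

locale flat_model = flat_chart +
  fixes e0 :: 'a and N :: "'a \<Rightarrow> 'a"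
  assumes linear_N: "linear N" and unit_e0: "e0 \<bullet> e0 = 1" and N_orth: "N v \<bullet> e0 = 0"
begin

definition drift :: "'a \<Rightarrow> 'a" where
  "drift p = e0 + N (\<theta> p)"

definition affine_distrib :: "'a set \<Rightarrow> 'a distrib" where
  "affine_distrib L p = {v. J p v \<in> span (insert (drift p) L)}"

definition vertical :: "'a set \<Rightarrow> bool" where
  "vertical L \<longleftrightarrow> subspace L \<and> (\<forall>l\<in>L. l \<bullet> e0 = 0)"

definition grow :: "'a set \<Rightarrow> 'a set" where
  "grow L = span (L \<union> N ` L)"

definition stable_part :: "'a set \<Rightarrow> 'a set" where
  "stable_part L = {l \<in> L. N l \<in> L}"

text \<open>A section \<open>X\<close> splits as \<open>J X = a D + b\<close> with the drift \<open>D\<close>; the next two functions are \<open>a\<close>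
  and \<open>b\<close>.\<close>

definition time_part :: "('a \<Rightarrow> 'a) \<Rightarrow> 'a \<Rightarrow> real" where
  "time_part X p = J p (X p) \<bullet> e0"

definition vert_part :: "('a \<Rightarrow> 'a) \<Rightarrow> 'a \<Rightarrow> 'a" where
  "vert_part X p = J p (X p) - time_part X p *\<^sub>R drift p"

text \<open>These sections suffice to reach every vector of the distribution and to test every bracket.\<close>

definition model_field :: "real \<Rightarrow> 'a \<Rightarrow> 'a \<Rightarrow> 'a" where
  "model_field a l p = Ji p (a *\<^sub>R drift p + l)"

lemma vertical_subspace: "vertical L \<Longrightarrow> subspace L"
  and vertical_orth: "vertical L \<Longrightarrow> l \<in> L \<Longrightarrow> l \<bullet> e0 = 0"
  by (auto simp: vertical_def)

lemma drift_e0: "drift p \<bullet> e0 = 1"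
  by (simp add: drift_def inner_add_left unit_e0 N_orth)

lemma smooth_drift: "smooth_on U drift"
  unfolding drift_def
  by (intro smooth_on_add open_U smooth_on_const smooth_on_linear[OF linear_N] smooth_chart)

lemma vertical_span:
  assumes "\<And>x. x \<in> S \<Longrightarrow> x \<bullet> e0 = 0"
  shows "vertical (span S)"
proof -
  have "span S \<subseteq> {x. x \<bullet> e0 = 0}"
    using assms by (intro span_minimal) (auto simp: subspace_def inner_add_left)
  then show ?thesis by (auto simp: vertical_def)
qed

lemma vertical_grow: "vertical L \<Longrightarrow> vertical (grow L)"
  unfolding grow_def by (intro vertical_span) (auto simp: N_orth vertical_orth)

lemma grow_superset: "L \<subseteq> grow L" and N_in_grow: "l \<in> L \<Longrightarrow> N l \<in> grow L"
  by (auto simp: grow_def intro: span_base)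

lemma subspace_stable_part: "vertical L \<Longrightarrow> subspace (stable_part L)"
  using linear_N by (auto simp: vertical_def stable_part_def subspace_def linear_add linear_scale linear_0)

lemma stable_part_subset: "stable_part L \<subseteq> L"
  by (auto simp: stable_part_def)

lemma in_span_drift:
  assumes "vertical L"
  shows "w \<in> span (insert (drift p) L) \<longleftrightarrow> w - (w \<bullet> e0) *\<^sub>R drift p \<in> L"
proof
  assume "w \<in> span (insert (drift p) L)"
  then obtain k where k: "w - k *\<^sub>R drift p \<in> L"
    using span_eq_iff[THEN iffD2, OF vertical_subspace[OF assms]]
    by (auto simp: span_insert)
  then have "w \<bullet> e0 = k"
    using vertical_orth[OF assms k] by (simp add: inner_diff_left drift_e0)
  with k show "w - (w \<bullet> e0) *\<^sub>R drift p \<in> L" by simp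
next
  assume "w - (w \<bullet> e0) *\<^sub>R drift p \<in> L"
  then show "w \<in> span (insert (drift p) L)"
    by (auto simp: span_insert intro: span_base)
qed

lemma in_span_driftI: "l \<in> L \<Longrightarrow> a *\<^sub>R drift p + l \<in> span (insert (drift p) L)"
  by (intro span_add span_scale span_base) simp_all

lemma in_span_drift_vertical:
  assumes "vertical L" "w \<bullet> e0 = 0"
  shows "w \<in> span (insert (drift p) L) \<longleftrightarrow> w \<in> L"
  using in_span_drift[OF assms(1)] assms(2) by simp

lemma dim_span_drift:
  assumes "vertical L"
  shows "dim (span (insert (drift p) L)) = Suc (dim L)"
proof -
  have "drift p \<notin> span L"
    using vertical_orth[OF assms, of "drift p"] drift_e0[of p]
    unfolding span_eq_iff[THEN iffD2, OF vertical_subspace[OF assms]] by auto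
  then show ?thesis by (simp add: dim_insert)
qed

lemma subspace_affine: "p \<in> U \<Longrightarrow> subspace (affine_distrib L p)"
  unfolding affine_distrib_def by (rule subspace_preimage_J) auto

lemma dim_affine: "p \<in> U \<Longrightarrow> vertical L \<Longrightarrow> dim (affine_distrib L p) = Suc (dim L)"
  unfolding affine_distrib_def by (simp only: dim_preimage_J dim_span_drift)

lemma affine_mono: "L \<subseteq> L' \<Longrightarrow> affine_distrib L p \<subseteq> affine_distrib L' p"
  unfolding affine_distrib_def using span_mono[of "insert (drift p) L" "insert (drift p) L'"] by auto

lemma J_model_field: "p \<in> U \<Longrightarrow> J p (model_field a l p) = a *\<^sub>R drift p + l"
  by (simp add: model_field_def J_Ji)

lemma smooth_model_field: "smooth_on U (model_field a l)"
  unfolding model_field_def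
  by (intro smooth_Ji smooth_on_add smooth_on_scaleR open_U smooth_on_const smooth_drift)

lemma model_field_section:
  assumes "l \<in> L"
  shows "model_field a l \<in> sections U (affine_distrib L)"
  by (simp add: sections_def smooth_model_field affine_distrib_def J_model_field
      in_span_driftI[OF assms])

lemma model_field_parts:
  assumes "p \<in> U" "l \<bullet> e0 = 0"
  shows "time_part (model_field a l) p = a" "vert_part (model_field a l) p = l"
  using assms by (simp_all add: time_part_def vert_part_def J_model_field inner_add_left drift_e0)

lemma section_smooth: "X \<in> sections U V \<Longrightarrow> smooth_on U X"
  by (simp add: sections_def)

lemma section_vert_part:
  assumes "vertical L" "X \<in> sections U (affine_distrib L)" "p \<in> U"
  shows "vert_part X p \<in> L"
  using assms in_span_drift[OF assms(1), of "J p (X p)" p]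
  by (auto simp: sections_def affine_distrib_def vert_part_def time_part_def)

lemma section_through:
  assumes "vertical L" "p \<in> U" "v \<in> affine_distrib L p"
  obtains X where "X \<in> sections U (affine_distrib L)" "X p = v"
proof
  let ?a = "J p v \<bullet> e0" and ?l = "J p v - (J p v \<bullet> e0) *\<^sub>R drift p"
  have "?l \<in> L"
    using assms in_span_drift[OF assms(1)] by (simp add: affine_distrib_def)
  then show "model_field ?a ?l \<in> sections U (affine_distrib L)" by (rule model_field_section)
  show "model_field ?a ?l p = v" by (simp add: model_field_def Ji_J assms(2))
qed

lemma section_values:
  assumes "vertical L" "p \<in> U"
  shows "{X p |X. X \<in> sections U (affine_distrib L)} = affine_distrib L p"
proof (intro equalityI subsetI)
  fix v assume "v \<in> affine_distrib L p"
  then obtain X where "X \<in> sections U (affine_distrib L)" "X p = v"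
    by (rule section_through[OF assms])
  then show "v \<in> {X p |X. X \<in> sections U (affine_distrib L)}" by blast
qed (use assms(2) in \<open>auto simp: sections_def\<close>)

lemma smooth_time_part: "smooth_on U X \<Longrightarrow> smooth_on U (time_part X)"
  unfolding time_part_def by (rule smooth_on_inner[OF open_U smooth_J smooth_on_const])

lemma smooth_vert_part: "smooth_on U X \<Longrightarrow> smooth_on U (vert_part X)"
  unfolding vert_part_def
  by (rule smooth_on_diff[OF open_U smooth_J smooth_on_scaleR[OF open_U smooth_time_part smooth_drift]])

text \<open>Modulo the distribution only the derivative of the drift survives: the derivative of \<open>a\<close>
  multiplies the drift, and that of the \<open>L\<close>-valued function \<open>b\<close> stays in \<open>L\<close>.\<close>

lemma derivative_of_section:
  assumes "vertical L" "X \<in> sections U (affine_distrib L)" "p \<in> U"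
  shows "frechet_derivative (\<lambda>q. J q (X q)) (at p) v - time_part X p *\<^sub>R N (J p v)
          \<in> span (insert (drift p) L)"
proof -
  note sm = section_smooth[OF assms(2)]
  let ?Da = "frechet_derivative (time_part X) (at p)" and ?Db = "frechet_derivative (vert_part X) (at p)"
  have a: "(time_part X has_derivative ?Da) (at p)"
    by (rule smooth_on_has_derivative[OF smooth_time_part[OF sm] assms(3)])
  have b: "(vert_part X has_derivative ?Db) (at p)"
    by (rule smooth_on_has_derivative[OF smooth_vert_part[OF sm] assms(3)])
  have "((\<lambda>q. N (\<theta> q)) has_derivative (\<lambda>v. N (J p v))) (at p)"
    by (rule bounded_linear.has_derivative[OF _ has_derivative_chart[OF assms(3)]])
       (simp add: linear_conv_bounded_linear[symmetric] linear_N)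
  then have d: "(drift has_derivative (\<lambda>v. N (J p v))) (at p)"
    unfolding drift_def by (auto intro!: derivative_eq_intros)
  have "((\<lambda>q. time_part X q *\<^sub>R drift q + vert_part X q) has_derivative
      (\<lambda>v. (time_part X p *\<^sub>R N (J p v) + ?Da v *\<^sub>R drift p) + ?Db v)) (at p)"
    by (intro has_derivative_add has_derivative_scaleR a b d)
  from frechet_derivative_at[OF this]
  have "frechet_derivative (\<lambda>q. J q (X q)) (at p) =
      (\<lambda>v. (time_part X p *\<^sub>R N (J p v) + ?Da v *\<^sub>R drift p) + ?Db v)"
    by (simp add: vert_part_def)
  then have "frechet_derivative (\<lambda>q. J q (X q)) (at p) v - time_part X p *\<^sub>R N (J p v) =
      ?Da v *\<^sub>R drift p + ?Db v" by simp
  moreover have "?Db v \<in> L"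
    by (rule derivative_in_subspace[OF open_U assms(3) vertical_subspace[OF assms(1)] _ b])
       (rule section_vert_part[OF assms(1,2)])
  ultimately show ?thesis by (simp only: in_span_driftI)
qed

text \<open>The fundamental formula \<open>[a D + b, a' D + b'] \<equiv> a' N b - a N b'\<close>. The terms \<open>a a' N D\<close>
  cancel by antisymmetry.\<close>

lemma J_bracket_mod:
  assumes "vertical L" "X \<in> sections U (affine_distrib L)" "Y \<in> sections U (affine_distrib L)"
    and "p \<in> U"
  shows "J p (lie_bracket X Y p) -
     (time_part Y p *\<^sub>R N (vert_part X p) - time_part X p *\<^sub>R N (vert_part Y p))
       \<in> span (insert (drift p) L)"
proof -
  let ?S = "span (insert (drift p) L)"
  let ?DX = "frechet_derivative (\<lambda>q. J q (X q)) (at p)" and ?DY = "frechet_derivative (\<lambda>q. J q (Y q)) (at p)"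
  have NX: "N (vert_part Z p) = N (J p (Z p)) - time_part Z p *\<^sub>R N (drift p)" for Z
    by (simp add: vert_part_def linear_diff[OF linear_N] linear_scale[OF linear_N])
  have "(?DY (X p) - time_part Y p *\<^sub>R N (J p (X p))) - (?DX (Y p) - time_part X p *\<^sub>R N (J p (Y p))) \<in> ?S"
    by (intro span_diff derivative_of_section assms)
  moreover have "J p (lie_bracket X Y p) = ?DY (X p) - ?DX (Y p)"
    by (intro J_lie_bracket section_smooth[OF assms(2)] section_smooth[OF assms(3)] assms(4))
  then have "J p (lie_bracket X Y p) -
      (time_part Y p *\<^sub>R N (vert_part X p) - time_part X p *\<^sub>R N (vert_part Y p)) =
    (?DY (X p) - time_part Y p *\<^sub>R N (J p (X p))) - (?DX (Y p) - time_part X p *\<^sub>R N (J p (Y p)))"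
    unfolding NX by (simp add: algebra_simps)
  ultimately show ?thesis by simp
qed

lemma smooth_lie_bracket: "smooth_on U X \<Longrightarrow> smooth_on U Y \<Longrightarrow> smooth_on U (lie_bracket X Y)"
  unfolding lie_bracket_def
  by (rule smooth_on_diff[OF open_U smooth_on_derivative_along[OF open_U]
        smooth_on_derivative_along[OF open_U]])

text \<open>A criterion for a space of tangent vectors to exhaust the derived bundle; it serves both for
  the derived bundle and for the polar map of a transversal vector.\<close>

lemma affine_grow_least:
  assumes "p \<in> U" "subspace S" "affine_distrib L p \<subseteq> S" "\<And>l. l \<in> L \<Longrightarrow> Ji p (N l) \<in> S"
  shows "affine_distrib (grow L) p \<subseteq> S"
proof -
  have S: "subspace (J p ` S)"
    by (rule linear_subspace_image[OF linear_J[OF assms(1)] assms(2)])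
  have 1: "w \<in> J p ` S" if "Ji p w \<in> S" for w
    using that J_Ji[OF assms(1), of w] by (metis imageI)
  have 2: "Ji p w \<in> S" if "w \<in> insert (drift p) L" for w
    using assms(3) that by (auto simp: affine_distrib_def J_Ji[OF assms(1)] span_base)
  have "grow L \<subseteq> J p ` S"
    unfolding grow_def using 1 2 assms(4) by (intro span_minimal S) auto
  then have "span (insert (drift p) (grow L)) \<subseteq> J p ` S"
    using 1 2 by (intro span_minimal S) auto
  moreover have "v \<in> S" if Jv: "J p v \<in> J p ` S" for v
  proof -
    obtain s where s: "s \<in> S" "J p v = J p s" using Jv by blast
    from arg_cong[OF s(2), of "Ji p"] have "v = s" by (simp only: Ji_J[OF assms(1)])
    with s(1) show ?thesis by simp
  qed
  ultimately show ?thesis unfolding affine_distrib_def by blast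
qed

lemma bracket_in_grow:
  assumes "vertical L" "X \<in> sections U (affine_distrib L)" "Y \<in> sections U (affine_distrib L)"
    and "p \<in> U"
  shows "lie_bracket X Y p \<in> affine_distrib (grow L) p"
proof -
  let ?S = "span (insert (drift p) (grow L))"
  let ?w = "time_part Y p *\<^sub>R N (vert_part X p) - time_part X p *\<^sub>R N (vert_part Y p)"
  have "J p (lie_bracket X Y p) - ?w \<in> ?S"
    using J_bracket_mod[OF assms] span_mono[of "insert (drift p) L" "insert (drift p) (grow L)"]
      grow_superset by blast
  moreover have "?w \<in> ?S"
    using section_vert_part[OF assms(1,2,4)] section_vert_part[OF assms(1,3,4)]
    by (intro span_diff span_scale span_base) (auto intro: N_in_grow)
  ultimately have "J p (lie_bracket X Y p) \<in> ?S"
    using span_add[of "J p (lie_bracket X Y p) - ?w" _ ?w] by simp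
  then show ?thesis by (simp add: affine_distrib_def)
qed

text \<open>Bracketing with the constant fields \<open>l \<in> L\<close> detects the drift component of a section.\<close>

lemma bracket_with_vertical_field:
  assumes "vertical L" "X \<in> sections U (affine_distrib L)" "l \<in> L" "p \<in> U"
  shows "J p (lie_bracket X (model_field 0 l) p) + time_part X p *\<^sub>R N l \<in> span (insert (drift p) L)"
  using J_bracket_mod[OF assms(1,2) model_field_section[OF assms(3), of 0] assms(4)]
    model_field_parts[OF assms(4) vertical_orth[OF assms(1,3)], of 0] by simp

text \<open>Brackets stay in the span of the drift and \<open>L + N L\<close>; conversely the bracket of the drift with
  the constant field \<open>l\<close> is \<open>- N l\<close> modulo the distribution.\<close>

lemma derived_affine:
  assumes "vertical L" "p \<in> U"
  shows "derived_bundle U (affine_distrib L) p = affine_distrib (grow L) p"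
proof
  let ?V = "affine_distrib L"
  have "X p \<in> affine_distrib (grow L) p" if "X \<in> sections U ?V" for X
    using that assms(2) affine_mono[OF grow_superset] by (auto simp: sections_def)
  then show "derived_bundle U ?V p \<subseteq> affine_distrib (grow L) p"
    unfolding derived_bundle_def brackets_def
    using bracket_in_grow[OF assms(1) _ _ assms(2)] subspace_affine[OF assms(2)]
    by (intro span_minimal) auto
  have sub: "?V p \<subseteq> derived_bundle U ?V p"
    unfolding derived_bundle_def section_values[OF assms] by (auto intro: span_base)
  show "affine_distrib (grow L) p \<subseteq> derived_bundle U ?V p"
  proof (rule affine_grow_least[OF assms(2) _ sub])
    show S: "subspace (derived_bundle U ?V p)" by (simp add: derived_bundle_def)
    fix l assume l: "l \<in> L"
    have 0: "0 \<in> L" using assms(1) by (simp add: vertical_def subspace_0)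
    let ?B = "lie_bracket (model_field 1 0) (model_field 0 l) p"
    have "J p ?B + N l \<in> span (insert (drift p) L)"
      using bracket_with_vertical_field[OF assms(1) model_field_section[OF 0, of 1] l assms(2)]
      by (simp add: model_field_parts[OF assms(2)])
    then have "?B + Ji p (N l) \<in> ?V p"
      using linear_add[OF linear_J[OF assms(2)]] by (simp add: affine_distrib_def J_Ji[OF assms(2)])
    moreover have "?B \<in> derived_bundle U ?V p"
      unfolding derived_bundle_def brackets_def
      using model_field_section[OF 0, of 1] model_field_section[OF l, of 0] by (auto intro!: span_base)
    ultimately have "?B + Ji p (N l) - ?B \<in> derived_bundle U ?V p"
      using sub S by (blast intro: subspace_diff)
    then show "Ji p (N l) \<in> derived_bundle U ?V p" by simp
  qed
qed

lemma structure_rank_affine: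
  assumes "vertical L" "p \<in> U"
  shows "structure_rank U (affine_distrib L) p = dim (grow L) - dim L"
proof -
  have "span (brackets U (affine_distrib L) p \<union> affine_distrib L p) = affine_distrib (grow L) p"
    using derived_affine[OF assms] section_values[OF assms] by (simp add: derived_bundle_def Un_commute)
  then have "dim (brackets U (affine_distrib L) p \<union> affine_distrib L p) = Suc (dim (grow L))"
    using dim_affine[OF assms(2) vertical_grow[OF assms(1)]] by (metis dim_span)
  then show ?thesis
    by (simp add: structure_rank_def quot_dim_def dim_affine[OF assms(2,1)])
qed

text \<open>When \<open>N L \<subseteq> L\<close>, the distribution is involutive and every section is a Cauchy field.\<close>

lemma cauchy_affine_stable:
  assumes "vertical L" "N ` L \<subseteq> L" "p \<in> U"
  shows "cauchy_bundle U (affine_distrib L) p = affine_distrib L p"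
proof -
  have "grow L = L"
    unfolding grow_def using assms(1,2) by (simp add: Un_absorb2 vertical_subspace)
  then have br: "lie_bracket X Y \<in> sections U (affine_distrib L)"
    if "X \<in> sections U (affine_distrib L)" "Y \<in> sections U (affine_distrib L)" for X Y
    using bracket_in_grow[OF assms(1) that] smooth_lie_bracket section_smooth[OF that(1)]
      section_smooth[OF that(2)] by (auto simp: sections_def)
  have "cauchy_bundle U (affine_distrib L) p = {X p |X. X \<in> sections U (affine_distrib L)}"
    unfolding cauchy_bundle_def using br by blast
  then show ?thesis by (simp only: section_values[OF assms(1,3)])
qed

text \<open>A Cauchy field has no drift component, as seen from its bracket with some \<open>l \<in> L\<close> such that
  \<open>N l \<notin> L\<close>; its bracket with the drift then forces \<open>N b \<in> L\<close>. Conversely, each \<open>l \<in> L\<close> with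
  \<open>N l \<in> L\<close> extends to a constant Cauchy field.\<close>

lemma cauchy_affine:
  assumes "vertical L" "\<not> N ` L \<subseteq> L" "p \<in> U"
  shows "cauchy_bundle U (affine_distrib L) p = {v. J p v \<in> stable_part L}"
proof
  note vL = assms(1)
  let ?V = "affine_distrib L"
  show "cauchy_bundle U ?V p \<subseteq> {v. J p v \<in> stable_part L}"
  proof
    fix v assume "v \<in> cauchy_bundle U ?V p"
    then obtain X where X: "v = X p" "X \<in> sections U ?V"
      "\<And>Y. Y \<in> sections U ?V \<Longrightarrow> lie_bracket X Y \<in> sections U ?V"
      by (auto simp: cauchy_bundle_def)
    have B: "J p (lie_bracket X Y p) \<in> span (insert (drift p) L)" if "Y \<in> sections U ?V" for Y
      using X(3)[OF that] assms(3) by (auto simp: sections_def affine_distrib_def)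
    obtain l where l: "l \<in> L" "N l \<notin> L" using assms(2) by auto
    have "time_part X p *\<^sub>R N l \<in> span (insert (drift p) L)"
      using span_diff[OF bracket_with_vertical_field[OF vL X(2) l(1) assms(3)]
        B[OF model_field_section[OF l(1), of 0]]] by simp
    \<comment> \<open>\<open>N l\<close> has no time component, so it lies in the distribution only if it lies in \<open>L\<close>.\<close>
    then have "time_part X p *\<^sub>R N l \<in> L"
      using in_span_drift_vertical[OF vL] by (simp add: N_orth)
    then have a: "time_part X p = 0"
      using l(2) subspace_scale[OF vertical_subspace[OF vL], of "time_part X p *\<^sub>R N l" "inverse (time_part X p)"]
      by (cases "time_part X p = 0") auto
    have 0: "0 \<in> L" using vL by (simp add: vertical_def subspace_0)
    have "J p (lie_bracket X (model_field 1 0) p) - N (vert_part X p) \<in> span (insert (drift p) L)"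
      using J_bracket_mod[OF vL X(2) model_field_section[OF 0, of 1] assms(3)]
      by (simp add: model_field_parts[OF assms(3)] a)
    from span_diff[OF B[OF model_field_section[OF 0, of 1]] this]
    have "N (vert_part X p) \<in> L"
      using in_span_drift_vertical[OF vL] by (simp add: N_orth)
    moreover have "vert_part X p = J p v" by (simp add: vert_part_def a X(1))
    ultimately show "v \<in> {v. J p v \<in> stable_part L}"
      using section_vert_part[OF vL X(2) assms(3)] by (simp add: stable_part_def)
  qed
  show "{v. J p v \<in> stable_part L} \<subseteq> cauchy_bundle U ?V p"
  proof
    fix v assume v: "v \<in> {v. J p v \<in> stable_part L}"
    define l where "l = J p v"
    have l: "l \<in> L" "N l \<in> L" using v by (auto simp: l_def stable_part_def)
    have "lie_bracket (model_field 0 l) Y \<in> sections U ?V" if Y: "Y \<in> sections U ?V" for Y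
    proof -
      have "lie_bracket (model_field 0 l) Y q \<in> ?V q" if q: "q \<in> U" for q
      proof -
        have "J q (lie_bracket (model_field 0 l) Y q) - time_part Y q *\<^sub>R N l
            \<in> span (insert (drift q) L)"
          using J_bracket_mod[OF vL model_field_section[OF l(1), of 0] Y q]
          by (simp add: model_field_parts[OF q vertical_orth[OF vL l(1)]])
        moreover have "time_part Y q *\<^sub>R N l \<in> span (insert (drift q) L)"
          using l(2) by (intro span_scale span_base) simp
        ultimately have "J q (lie_bracket (model_field 0 l) Y q) - time_part Y q *\<^sub>R N l +
            time_part Y q *\<^sub>R N l \<in> span (insert (drift q) L)"
          by (rule span_add)
        then show ?thesis by (simp add: affine_distrib_def)
      qed
      then show ?thesis
        using smooth_lie_bracket[OF smooth_model_field section_smooth[OF Y]] by (simp add: sections_def)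
    qed
    moreover have "model_field 0 l p = v" by (simp add: model_field_def l_def Ji_J assms(3))
    ultimately show "v \<in> cauchy_bundle U ?V p"
      unfolding cauchy_bundle_def using model_field_section[OF l(1), of 0] by blast
  qed
qed

lemma sub_bundle_affine:
  assumes "vertical L"
  shows "sub_bundle U (Suc (dim L)) (affine_distrib L)"
proof -
  obtain g :: "nat \<Rightarrow> 'a" where g: "span (g ` {..<dim L}) = L"
    using basis_enumeration[OF vertical_subspace[OF assms]] by metis
  let ?Z = "\<lambda>i q. if i < dim L then g i else drift q"
  have "?Z i q \<in> insert (drift q) (g ` {..<dim L})" for i q by auto
  moreover have "insert (drift q) (g ` {..<dim L}) \<subseteq> (\<lambda>i. ?Z i q) ` {..<Suc (dim L)}" for q
    by (auto simp: image_iff intro: bexI[of _ "dim L"])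
  ultimately have im: "(\<lambda>i. ?Z i q) ` {..<Suc (dim L)} = insert (drift q) (g ` {..<dim L})" for q
    by blast
  have sp: "span ((\<lambda>i. ?Z i q) ` {..<Suc (dim L)}) = span (insert (drift q) L)" for q
    unfolding im using g by (simp add: span_insert span_eq_iff[THEN iffD2, OF vertical_subspace[OF assms]])
  show ?thesis
  proof (rule sub_bundle_preimage[where Z = ?Z])
    show "smooth_on U (\<lambda>q. ?Z i q)" for i
      by (cases "i < dim L") (simp_all add: smooth_on_const smooth_drift)
  qed (simp_all only: sp affine_distrib_def dim_span_drift[OF assms])
qed

end


section \<open>Derived flag and Cauchy bundles of a linear system\<close>

text \<open>All the constructions depend on a distribution over \<open>U\<close> only, and mostly through its
  sections. This matters because \<open>derived_flag U V 0\<close> is \<open>V\<close> itself, which need not be given by the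
  affine model outside \<open>U\<close>.\<close>

lemma sections_cong: "(\<And>p. p \<in> U \<Longrightarrow> V p = W p) \<Longrightarrow> sections U V = sections U W"
  by (auto simp: sections_def)

lemma derived_bundle_cong: "sections U V = sections U W \<Longrightarrow> derived_bundle U V = derived_bundle U W"
  by (rule ext) (simp add: derived_bundle_def brackets_def)

lemma cauchy_bundle_cong: "sections U V = sections U W \<Longrightarrow> cauchy_bundle U V = cauchy_bundle U W"
  by (rule ext) (simp add: cauchy_bundle_def)

lemma polar_rank_cong:
  "sections U V = sections U W \<Longrightarrow> V p = W p \<Longrightarrow> polar_rank U V p v = polar_rank U W p v"
  by (simp add: polar_rank_def)

lemma structure_rank_cong:
  "sections U V = sections U W \<Longrightarrow> V p = W p \<Longrightarrow> structure_rank U V p = structure_rank U W p"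
  by (simp add: structure_rank_def brackets_def)

lemma sub_bundle_cong:
  fixes V W :: "'a::euclidean_space distrib"
  assumes "\<And>p. p \<in> U \<Longrightarrow> V p = W p" "sub_bundle U r W"
  shows "sub_bundle U r V"
  unfolding sub_bundle_def
proof
  fix p assume "p \<in> U"
  then have "\<exists>S. open S \<and> p \<in> S \<and> S \<subseteq> U \<and>
        (\<exists>X::nat \<Rightarrow> 'a \<Rightarrow> 'a. (\<forall>i<r. smooth_on S (X i)) \<and>
           (\<forall>q\<in>S. W q = span ((\<lambda>i. X i q) ` {..<r}) \<and> dim (W q) = r))"
    by (rule bspec[OF assms(2)[unfolded sub_bundle_def]])
  then obtain S and X :: "nat \<Rightarrow> 'a \<Rightarrow> 'a" where "open S" "p \<in> S" "S \<subseteq> U" "\<forall>i<r. smooth_on S (X i)"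
    "\<forall>q\<in>S. W q = span ((\<lambda>i. X i q) ` {..<r}) \<and> dim (W q) = r"
    by (elim exE conjE) (rule that)
  moreover have "V q = span ((\<lambda>i. X i q) ` {..<r}) \<and> dim (V q) = r" if "q \<in> S" for q
  proof -
    have "V q = W q" using that \<open>S \<subseteq> U\<close> assms(1) by blast
    then show ?thesis using bspec[OF calculation(5) that] by argo
  qed
  ultimately show "\<exists>S. open S \<and> p \<in> S \<and> S \<subseteq> U \<and>
        (\<exists>X::nat \<Rightarrow> 'a \<Rightarrow> 'a. (\<forall>i<r. smooth_on S (X i)) \<and>
           (\<forall>q\<in>S. V q = span ((\<lambda>i. X i q) ` {..<r}) \<and> dim (V q) = r))"
    by (intro exI[of _ S] conjI exI[of _ X] ballI) blast+
qed

lemma bundle_rank_eqI: "U \<noteq> {} \<Longrightarrow> (\<And>p. p \<in> U \<Longrightarrow> dim (V p) = r) \<Longrightarrow> bundle_rank U V = r"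
  unfolding bundle_rank_def by (rule the_equality) auto

lemma derived_flag_Suc: "derived_flag U V (Suc i) = derived_bundle U (derived_flag U V i)"
  by (simp add: derived_flag_def)

context flat_model
begin

lemma vertical_funpow: "vertical L \<Longrightarrow> vertical ((grow ^^ i) L)"
  by (induction i) (auto simp: vertical_grow)

lemma derived_flag_affine:
  assumes "vertical L" "\<forall>p\<in>U. V p = affine_distrib L p" "p \<in> U"
  shows "derived_flag U V i p = affine_distrib ((grow ^^ i) L) p"
  using assms(3)
proof (induction i arbitrary: p)
  case 0
  then show ?case by (simp add: derived_flag_def assms(2))
next
  case (Suc i)
  have "derived_flag U V (Suc i) = derived_bundle U (affine_distrib ((grow ^^ i) L))"
    unfolding derived_flag_Suc by (intro derived_bundle_cong sections_cong Suc.IH)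
  then show ?case
    using derived_affine[OF vertical_funpow[OF assms(1)] Suc.prems] by simp
qed

lemma cauchy_flag:
  assumes "vertical L" "\<forall>p\<in>U. V p = affine_distrib L p"
  shows "cauchy_bundle U (derived_flag U V i) = cauchy_bundle U (affine_distrib ((grow ^^ i) L))"
  by (intro cauchy_bundle_cong sections_cong derived_flag_affine[OF assms])

lemma sub_bundle_cauchy_affine:
  assumes "vertical L"
  shows "\<exists>r. sub_bundle U r (cauchy_bundle U (affine_distrib L))"
proof (cases "N ` L \<subseteq> L")
  case True
  show ?thesis
    using sub_bundle_cong[OF cauchy_affine_stable[OF assms True] sub_bundle_affine[OF assms]] by blast
next
  case False
  show ?thesis
    using sub_bundle_constant[OF subspace_stable_part[OF assms] cauchy_affine[OF assms False]] by blast
qed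

lemma totally_regular_affine:
  assumes "vertical L" "\<forall>p\<in>U. V p = affine_distrib L p"
  shows "totally_regular U V"
proof -
  note flag = derived_flag_affine[OF assms]
  note v = vertical_funpow[OF assms(1)]
  have "\<exists>r. sub_bundle U r (derived_flag U V i)" for i
    by (rule exI, rule sub_bundle_cong[OF flag sub_bundle_affine[OF v]])
  moreover have sec: "sections U (derived_flag U V i) = sections U (affine_distrib ((grow ^^ i) L))" for i
    by (rule sections_cong) (rule flag)
  then have "structure_rank U (derived_flag U V i) p =
      dim (grow ((grow ^^ i) L)) - dim ((grow ^^ i) L)" if "p \<in> U" for i p
    by (simp only: structure_rank_cong[OF sec flag[OF that]] structure_rank_affine[OF v that])
  moreover have "\<exists>r. sub_bundle U r (cauchy_bundle U (derived_flag U V i))" for i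
    unfolding cauchy_flag[OF assms] by (rule sub_bundle_cauchy_affine[OF v])
  ultimately show ?thesis
    unfolding totally_regular_def regular_distrib_def by blast
qed

lemma m_rank_affine:
  assumes "vertical L" "\<forall>p\<in>U. V p = affine_distrib L p" "U \<noteq> {}"
  shows "m_rank U V i = Suc (dim ((grow ^^ i) L))"
  unfolding m_rank_def
  by (rule bundle_rank_eqI[OF assms(3)])
     (simp add: derived_flag_affine[OF assms(1,2)] dim_affine vertical_funpow[OF assms(1)])

lemma chi_rank_affine:
  assumes "vertical L" "\<forall>p\<in>U. V p = affine_distrib L p" "U \<noteq> {}"
  shows "chi_rank U V i = (let M = (grow ^^ i) L in
     if N ` M \<subseteq> M then Suc (dim M) else dim (stable_part M))"
  unfolding chi_rank_def cauchy_flag[OF assms(1,2)] Let_def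
  using vertical_funpow[OF assms(1), of i]
  by (intro bundle_rank_eqI[OF assms(3)])
     (auto simp: cauchy_affine_stable cauchy_affine dim_affine dim_preimage_J)

text \<open>All of \<open>L\<^sub>i\<close> is mapped by \<open>N\<close> into \<open>L\<^sub>i\<^sub>+\<^sub>1\<close>, so intersecting with the Cauchy bundle of the next
  derived bundle only removes the drift.\<close>

lemma cauchy_inter_affine:
  assumes "vertical L" "\<forall>p\<in>U. V p = affine_distrib L p" "p \<in> U"
    and "\<not> N ` (grow ^^ Suc i) L \<subseteq> (grow ^^ Suc i) L"
  shows "cauchy_inter U V (Suc i) p = {v. J p v \<in> (grow ^^ i) L}"
proof -
  let ?L = "(grow ^^ i) L"
  have vL: "vertical ?L" "vertical (grow ?L)"
    using vertical_funpow[OF assms(1), of i] by (auto intro: vertical_grow)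
  have "cauchy_inter U V (Suc i) p = affine_distrib ?L p \<inter> {v. J p v \<in> stable_part (grow ?L)}"
    using cauchy_affine[OF vL(2) _ assms(3)] assms(4) cauchy_flag[OF assms(1,2), of "Suc i"]
    by (simp add: cauchy_inter_def derived_flag_affine[OF assms(1-3)])
  also have "\<dots> = {v. J p v \<in> ?L}"
    using in_span_drift_vertical[OF vL(1)] vertical_orth[OF vL(2)] grow_superset[of ?L] N_in_grow[of _ ?L]
    by (auto simp: affine_distrib_def stable_part_def span_base)
  finally show ?thesis .
qed

end


section \<open>The Weber structure of a linear system\<close>

lemma coset_eq_iff:
  assumes "subspace C"
  shows "coset C v = coset C w \<longleftrightarrow> v - w \<in> C"
proof
  assume "coset C v = coset C w"
  moreover have "v \<in> coset C v"
    using subspace_0[OF assms] by (force simp: coset_def)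
  ultimately show "v - w \<in> C" by (auto simp: coset_def)
next
  assume d: "v - w \<in> C"
  have "coset C v \<subseteq> coset C w" if "v - w \<in> C" for v w
  proof
    fix x assume "x \<in> coset C v"
    then obtain c where "c \<in> C" "x = v + c" by (auto simp: coset_def)
    then have "x = w + (v - w + c)" "v - w + c \<in> C"
      using that subspace_add[OF assms] by auto
    then show "x \<in> coset C w" unfolding coset_def by blast
  qed
  from this[OF d] this[of w v] show "coset C v = coset C w"
    using d subspace_neg[OF assms, of "v - w"] by auto
qed

lemma coset_in_image_iff:
  assumes "subspace C" "subspace R" "C \<subseteq> R"
  shows "coset C v \<in> coset C ` R \<longleftrightarrow> v \<in> R"
proof
  assume "coset C v \<in> coset C ` R"
  then obtain w where w: "w \<in> R" "v - w \<in> C" using coset_eq_iff[OF assms(1)] by auto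
  then have "(v - w) + w \<in> R" using assms(2,3) by (blast intro: subspace_add)
  then show "v \<in> R" by simp
qed auto

context flat_model
begin

text \<open>On the orthogonal complement \<open>F\<close> of the stable part in \<open>L\<close>, the map \<open>N\<close> is injective
  modulo \<open>L\<close>, so that \<open>L + N L\<close> is the direct sum of \<open>L\<close> and \<open>N F\<close>. Hence the rank of the Cauchy
  bundle of a Weber structure is forced by the ranks in the derived flag, and \<open>F\<close> frames the
  singular sub-bundle.\<close>

lemma stable_complement:
  assumes "vertical L"
  obtains F where "subspace F" "F \<subseteq> L" "\<forall>l\<in>L. \<exists>k\<in>stable_part L. \<exists>f\<in>F. l = k + f"
    and "dim L = dim (stable_part L) + dim F" "dim (grow L) = dim L + dim F"
proof
  let ?K = "stable_part L"
  define F where "F = {y \<in> L. \<forall>x\<in>?K. orthogonal x y}"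
  have sL: "subspace L" by (rule vertical_subspace[OF assms])
  have sK: "subspace ?K" by (rule subspace_stable_part[OF assms])
  show sF: "subspace F"
    using sL by (auto simp: F_def subspace_def orthogonal_clauses)
  show FL: "F \<subseteq> L" by (auto simp: F_def)
  have decomp: "\<exists>k\<in>?K. \<exists>f\<in>F. l = k + f" if l: "l \<in> L" for l
  proof -
    obtain y z where yz: "y \<in> span ?K" "\<And>w. w \<in> span ?K \<Longrightarrow> orthogonal z w" "l = y + z"
      using orthogonal_subspace_decomp_exists by blast
    have y: "y \<in> ?K" using yz(1) sK by (simp add: span_eq_iff[THEN iffD2])
    then have "z \<in> L" using subspace_diff[OF sL l, of y] yz(3) stable_part_subset by auto
    then have "z \<in> F" using yz(2) by (auto simp: F_def orthogonal_commute span_base)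
    with y yz(3) show ?thesis by blast
  qed
  then show "\<forall>l\<in>L. \<exists>k\<in>?K. \<exists>f\<in>F. l = k + f" by blast
  show "dim L = dim ?K + dim F"
    using dim_subspace_orthogonal_to_vectors[OF sK sL stable_part_subset] by (simp add: F_def)
  have zero: "f = 0" if "f \<in> F" "N f \<in> L" for f
    using that by (auto simp: F_def stable_part_def orthogonal_self)
  have "inj_on N F"
  proof (rule inj_onI)
    fix x y assume xy: "x \<in> F" "y \<in> F" "N x = N y"
    then have "N (x - y) \<in> L" using subspace_0[OF sL] by (simp add: linear_diff[OF linear_N])
    then show "x = y" using zero[of "x - y"] subspace_diff[OF sF xy(1,2)] by simp
  qed
  then have dNF: "dim (N ` F) = dim F"
    using sF by (intro dim_image_eq[OF linear_N]) (simp add: span_eq_iff[THEN iffD2])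
  have sNF: "subspace (N ` F)" by (rule linear_subspace_image[OF linear_N sF])
  have "L \<inter> N ` F = {0}"
    using zero subspace_0[OF sL] subspace_0[OF sNF] linear_0[OF linear_N] by auto
  moreover have "grow L = {x + y |x y. x \<in> L \<and> y \<in> N ` F}"
  proof
    have "N l \<in> {x + y |x y. x \<in> L \<and> y \<in> N ` F}" if l: "l \<in> L" for l
    proof -
      obtain k f where "k \<in> ?K" "f \<in> F" "l = k + f" using decomp[OF l] by blast
      then have "N l = N k + N f" "N k \<in> L" "N f \<in> N ` F"
        by (auto simp: stable_part_def linear_add[OF linear_N])
      then show ?thesis by blast
    qed
    moreover have "l \<in> {x + y |x y. x \<in> L \<and> y \<in> N ` F}" if "l \<in> L" for l
      using that subspace_0[OF sNF] by (metis (mono_tags, lifting) add.right_neutral mem_Collect_eq)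
    ultimately show "grow L \<subseteq> {x + y |x y. x \<in> L \<and> y \<in> N ` F}"
      unfolding grow_def by (intro span_minimal subspace_sums sL sNF) blast
    show "{x + y |x y. x \<in> L \<and> y \<in> N ` F} \<subseteq> grow L"
    proof safe
      fix x f assume "x \<in> L" "f \<in> F"
      then show "x + N f \<in> grow L"
        unfolding grow_def using FL by (intro span_add span_base) auto
    qed
  qed
  ultimately show "dim (grow L) = dim L + dim F"
    using dim_sums_Int[OF sL sNF] dNF by simp
qed

text \<open>For \<open>a = 0\<close> the bracket is \<open>a' N b\<close>: a multiple of one fixed vector.\<close>

lemma polar_rank_vertical:
  assumes "vertical L" "p \<in> U" "J p v \<in> L"
  shows "polar_rank U (affine_distrib L) p v \<le> 1"
proof -
  let ?V = "affine_distrib L p"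
  let ?S = "{lie_bracket X Y p |X Y. X \<in> sections U (affine_distrib L) \<and>
              Y \<in> sections U (affine_distrib L) \<and> X p = v}"
  let ?n = "Ji p (N (J p v))"
  have "lie_bracket X Y p \<in> span (insert ?n ?V)"
    if X: "X \<in> sections U (affine_distrib L)" and Y: "Y \<in> sections U (affine_distrib L)"
      and Xv: "X p = v" for X Y
  proof -
    have "time_part X p = 0" "vert_part X p = J p v"
      using vertical_orth[OF assms(1,3)] by (simp_all add: time_part_def vert_part_def Xv)
    then have "J p (lie_bracket X Y p) - time_part Y p *\<^sub>R N (J p v) \<in> span (insert (drift p) L)"
      using J_bracket_mod[OF assms(1) X Y assms(2)] by simp
    then have "lie_bracket X Y p - time_part Y p *\<^sub>R ?n \<in> ?V"
      by (simp add: affine_distrib_def linear_diff[OF linear_J[OF assms(2)]]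
          linear_scale[OF linear_J[OF assms(2)]] J_Ji[OF assms(2)])
    from span_add[OF span_base[of _ "insert ?n ?V"] span_scale[OF span_base[of ?n "insert ?n ?V"]],
        OF insertI2[OF this] insertI1, of "time_part Y p"]
    show ?thesis by simp
  qed
  then have "?S \<union> ?V \<subseteq> span (insert ?n ?V)" by (auto intro: span_base)
  then have "dim (?S \<union> ?V) \<le> dim (insert ?n ?V)"
    using dim_subset[of "?S \<union> ?V" "span (insert ?n ?V)"] by simp
  also have "\<dots> \<le> dim ?V + 1" by (simp add: dim_insert)
  finally show ?thesis unfolding polar_rank_def quot_dim_def by linarith
qed

text \<open>For \<open>a \<noteq> 0\<close> the brackets with the constant fields already yield all of \<open>N L\<close>.\<close>

lemma polar_rank_transversal:
  assumes "vertical L" "p \<in> U" "v \<in> affine_distrib L p" "J p v \<bullet> e0 \<noteq> 0"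
  shows "polar_rank U (affine_distrib L) p v = dim (grow L) - dim L"
proof -
  let ?V = "affine_distrib L p"
  let ?S = "{lie_bracket X Y p |X Y. X \<in> sections U (affine_distrib L) \<and>
              Y \<in> sections U (affine_distrib L) \<and> X p = v}"
  obtain X where X: "X \<in> sections U (affine_distrib L)" "X p = v"
    by (rule section_through[OF assms(1-3)])
  let ?a = "time_part X p"
  have a: "?a \<noteq> 0" using assms(4) by (simp add: time_part_def X(2))
  have "span (?S \<union> ?V) = affine_distrib (grow L) p"
  proof
    show "span (?S \<union> ?V) \<subseteq> affine_distrib (grow L) p"
      using bracket_in_grow[OF assms(1) _ _ assms(2)] affine_mono[OF grow_superset]
      by (intro span_minimal subspace_affine[OF assms(2)]) blast
    show "affine_distrib (grow L) p \<subseteq> span (?S \<union> ?V)"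
    proof (rule affine_grow_least[OF assms(2)])
      fix l assume l: "l \<in> L"
      let ?B = "lie_bracket X (model_field 0 l) p"
      have "J p ?B + ?a *\<^sub>R N l \<in> span (insert (drift p) L)"
        by (rule bracket_with_vertical_field[OF assms(1) X(1) l assms(2)])
      then have "?B + ?a *\<^sub>R Ji p (N l) \<in> ?V"
        by (simp add: affine_distrib_def linear_add[OF linear_J[OF assms(2)]]
          linear_scale[OF linear_J[OF assms(2)]] J_Ji[OF assms(2)])
      then have "?B + ?a *\<^sub>R Ji p (N l) \<in> span (?S \<union> ?V)" by (simp add: span_base)
      moreover have "?B \<in> span (?S \<union> ?V)"
        using X model_field_section[OF l, of 0] by (intro span_base) blast
      ultimately have "?B + ?a *\<^sub>R Ji p (N l) - ?B \<in> span (?S \<union> ?V)" by (rule span_diff)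
      then have "?a *\<^sub>R Ji p (N l) \<in> span (?S \<union> ?V)" by (simp only: add_diff_cancel_left')
      then have "inverse ?a *\<^sub>R (?a *\<^sub>R Ji p (N l)) \<in> span (?S \<union> ?V)"
        by (rule span_scale)
      then show "Ji p (N l) \<in> span (?S \<union> ?V)"
        using a by simp
    next
      show "?V \<subseteq> span (?S \<union> ?V)" using span_superset[of "?S \<union> ?V"] by blast
    qed simp
  qed
  then have "dim (?S \<union> ?V) = Suc (dim (grow L))"
    using dim_affine[OF assms(2) vertical_grow[OF assms(1)]] dim_span[of "?S \<union> ?V"] by simp
  then show ?thesis
    by (simp add: polar_rank_def quot_dim_def dim_affine[OF assms(2,1)])
qed

lemma vertical_in_affine: "l \<in> L \<Longrightarrow> J p v = l \<Longrightarrow> v \<in> affine_distrib L p"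
  by (simp add: affine_distrib_def span_base)

lemma affine_time_zero_iff:
  assumes "vertical L"
  shows "v \<in> affine_distrib L p \<and> J p v \<bullet> e0 = 0 \<longleftrightarrow> J p v \<in> L"
  using in_span_drift_vertical[OF assms, of "J p v" p] vertical_orth[OF assms, of "J p v"]
  by (auto simp: affine_distrib_def span_base)

text \<open>Over \<open>U\<close>, the distribution \<open>W\<close> is the affine one given by \<open>L\<close>, one derivation reaches the full
  tangent space, and it adds \<open>q \<ge> 2\<close> dimensions. This is the situation at the last step of a derived
  flag, and these ranks alone make \<open>W\<close> an integrable Weber structure.\<close>

context
  fixes L :: "'a set" and W :: "'a distrib" and q :: nat
  assumes vL: "vertical L" and W: "\<And>p. p \<in> U \<Longrightarrow> W p = affine_distrib L p"
    and q: "q \<ge> 2" and dim_grow: "dim (grow L) = dim L + q" and DIM: "DIM('a) = Suc (dim (grow L))"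
begin

lemma not_stable: "\<not> N ` L \<subseteq> L"
proof
  assume "N ` L \<subseteq> L"
  then have "grow L = L"
    unfolding grow_def using vL by (simp add: Un_absorb2 vertical_subspace)
  then show False using dim_grow q by simp
qed

lemma W_affine: "\<forall>p\<in>U. W p = affine_distrib L p"
  using W by blast

lemma sections_W: "sections U W = sections U (affine_distrib L)"
  by (rule sections_cong) (rule W)

lemma cauchy_bundle_W: "p \<in> U \<Longrightarrow> cauchy_bundle U W p = {v. J p v \<in> stable_part L}"
  unfolding cauchy_bundle_cong[OF sections_W] by (rule cauchy_affine[OF vL not_stable])

lemma polar_rank_W: "p \<in> U \<Longrightarrow> polar_rank U W p v = polar_rank U (affine_distrib L) p v"
  by (rule polar_rank_cong[OF sections_W W])

text \<open>The value \<open>q\<close> is attained by the drift, which is not a Cauchy vector.\<close>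

lemma generic_rank_W:
  assumes p: "p \<in> U"
  shows "generic_rank U W p = q"
  unfolding generic_rank_def
proof (rule Max_eqI)
  let ?D = "W p - cauchy_bundle U W p"
  have le: "polar_rank U W p v \<le> q" if "v \<in> W p" for v
    using that polar_rank_vertical[OF vL p, of v] polar_rank_transversal[OF vL p, of v]
      affine_time_zero_iff[OF vL, of v p] dim_grow q
    by (cases "J p v \<bullet> e0 = 0") (auto simp: polar_rank_W[OF p] W[OF p])
  then have "polar_rank U W p ` ?D \<subseteq> {..q}" by auto
  then show "finite (polar_rank U W p ` ?D)" by (rule finite_subset) simp
  show "y \<le> q" if "y \<in> polar_rank U W p ` ?D" for y
    using that le by auto
  let ?v = "Ji p (drift p)"
  have "?v \<in> affine_distrib L p"
    by (simp add: affine_distrib_def J_Ji[OF p] span_base)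
  moreover have "J p ?v \<bullet> e0 \<noteq> 0" by (simp add: J_Ji[OF p] drift_e0)
  ultimately have "?v \<in> ?D" "polar_rank U W p ?v = q"
    using polar_rank_transversal[OF vL p] vertical_orth[OF vL, of "J p ?v"] stable_part_subset[of L]
    by (auto simp: polar_rank_W[OF p] cauchy_bundle_W[OF p] W[OF p] dim_grow)
  then show "q \<in> polar_rank U W p ` ?D" by (metis imageI)
qed

text \<open>The singular sub-bundle: the image of the constant space \<open>L\<close> modulo the Cauchy bundle.\<close>

definition singular_quotient :: "'a \<Rightarrow> 'a set set" where
  "singular_quotient p = coset (cauchy_bundle U W p) ` {v. J p v \<in> L}"

lemma in_singular_quotient:
  assumes "p \<in> U"
  shows "coset (cauchy_bundle U W p) v \<in> singular_quotient p \<longleftrightarrow> J p v \<in> L"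
proof -
  have "coset (cauchy_bundle U W p) v \<in> singular_quotient p \<longleftrightarrow> v \<in> {v. J p v \<in> L}"
    unfolding singular_quotient_def cauchy_bundle_W[OF assms]
    by (rule coset_in_image_iff)
       (use stable_part_subset[of L] in \<open>auto intro!: subspace_preimage_J[OF assms]
          subspace_stable_part[OF vL] vertical_subspace[OF vL]\<close>)
  then show ?thesis by simp
qed

text \<open>The bound \<open>q \<ge> 2\<close> enters here: it separates the polar rank of a vector in \<open>L\<close>, which is at
  most one, from the generic rank \<open>q\<close>.\<close>

lemma sing_lines_W:
  assumes p: "p \<in> U"
  shows "sing_lines U W p = quot_lines (cauchy_bundle U W p) (singular_quotient p)"
proof -
  let ?C = "cauchy_bundle U W p"
  have "v \<in> W p - ?C \<and> polar_rank U W p v < q \<longleftrightarrow> v \<notin> ?C \<and> J p v \<in> L" for v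
    using polar_rank_vertical[OF vL p, of v] polar_rank_transversal[OF vL p, of v]
      affine_time_zero_iff[OF vL, of v p] dim_grow q
    by (cases "J p v \<bullet> e0 = 0") (auto simp: polar_rank_W[OF p] W[OF p])
  then show ?thesis
    by (simp add: sing_lines_def quot_lines_def generic_rank_W[OF p] in_singular_quotient[OF p])
qed

lemma singular_quotient_rank:
  "dim L = dim (stable_part L) + q" "quot_sub_bundle U W (cauchy_bundle U W) q singular_quotient"
proof -
  let ?K = "stable_part L"
  obtain F where F: "subspace F" "F \<subseteq> L" "\<forall>l\<in>L. \<exists>k\<in>?K. \<exists>f\<in>F. l = k + f"
    "dim L = dim ?K + dim F" "dim (grow L) = dim L + dim F"
    by (rule stable_complement[OF vL])
  have dF: "dim F = q" using F(5) dim_grow by simp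
  with F(4) show "dim L = dim ?K + q" by simp
  obtain g :: "nat \<Rightarrow> 'a" where g: "span (g ` {..<q}) = F" "\<And>i. i < q \<Longrightarrow> g i \<in> F"
    using basis_enumeration[OF F(1)] dF by metis
  let ?X = "\<lambda>i. model_field 0 (g i)"
  have sec: "?X i \<in> sections U W" if "i < q" for i
    unfolding sections_W using model_field_section g(2)[OF that] F(2) by blast
  have span_X: "span ((\<lambda>i. ?X i p) ` {..<q}) = {v. J p v \<in> F}" if p: "p \<in> U" for p
    using linear_span_image[OF linear_Ji[OF p], of "g ` {..<q}"] g(1)
    by (simp add: preimage_J[OF p] image_image model_field_def)
  have decomp: "\<exists>c\<in>cauchy_bundle U W p. \<exists>x. J p x \<in> F \<and> v = x + c"
    if p: "p \<in> U" and v: "J p v \<in> L" for p v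
  proof -
    obtain k f where kf: "k \<in> ?K" "f \<in> F" "J p v = k + f" using F(3) v by blast
    have "v = Ji p f + Ji p k"
      using Ji_J[OF p, of v] kf(3) linear_add[OF linear_Ji[OF p], of k f]
      by (simp add: add.commute)
    then show ?thesis
      using kf by (intro bexI[of _ "Ji p k"] exI[of _ "Ji p f"])
        (auto simp: cauchy_bundle_W[OF p] J_Ji[OF p])
  qed
  have B: "singular_quotient p = coset (cauchy_bundle U W p) ` {v. J p v \<in> F}" if p: "p \<in> U" for p
  proof -
    have sC: "subspace (cauchy_bundle U W p)"
      unfolding cauchy_bundle_W[OF p] by (intro subspace_preimage_J[OF p] subspace_stable_part[OF vL])
    have "coset (cauchy_bundle U W p) v \<in> coset (cauchy_bundle U W p) ` {v. J p v \<in> F}"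
      if v: "J p v \<in> L" for v
    proof -
      obtain c x where cx: "c \<in> cauchy_bundle U W p" "J p x \<in> F" "v = x + c"
        using decomp[OF p v] by blast
      then have "coset (cauchy_bundle U W p) v = coset (cauchy_bundle U W p) x"
        by (simp add: coset_eq_iff[OF sC])
      with cx(2) show ?thesis by blast
    qed
    then show ?thesis unfolding singular_quotient_def using F(2) by blast
  qed
  have qd: "quot_dim (cauchy_bundle U W p) ((\<lambda>i. ?X i p) ` {..<q}) = q" if p: "p \<in> U" for p
  proof -
    let ?A = "(\<lambda>i. ?X i p) ` {..<q}" and ?C = "cauchy_bundle U W p"
    have "span (?A \<union> ?C) = {v. J p v \<in> L}"
    proof
      have "?A \<subseteq> {v. J p v \<in> F}" using span_X[OF p] span_superset[of ?A] by simp
      then show "span (?A \<union> ?C) \<subseteq> {v. J p v \<in> L}"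
        using F(2) stable_part_subset[of L]
        by (intro span_minimal subspace_preimage_J[OF p] vertical_subspace[OF vL])
           (auto simp: cauchy_bundle_W[OF p])
      show "{v. J p v \<in> L} \<subseteq> span (?A \<union> ?C)"
      proof
        fix v assume "v \<in> {v. J p v \<in> L}"
        then obtain c x where cx: "c \<in> ?C" "J p x \<in> F" "v = x + c"
          using decomp[OF p] by blast
        have "x \<in> span ?A" using cx(2) span_X[OF p] by simp
        then have "x \<in> span (?A \<union> ?C)" using span_mono[of ?A "?A \<union> ?C"] by blast
        with cx show "v \<in> span (?A \<union> ?C)" by (simp add: span_add span_base)
      qed
    qed
    then have "dim (?A \<union> ?C) = dim L" using dim_preimage_J[OF p, of L] by (metis dim_span)
    moreover have "dim ?C = dim ?K" unfolding cauchy_bundle_W[OF p] by (rule dim_preimage_J[OF p])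
    ultimately show ?thesis using F(4) dF by (simp add: quot_dim_def)
  qed
  show "quot_sub_bundle U W (cauchy_bundle U W) q singular_quotient"
    unfolding quot_sub_bundle_def
  proof
    fix p assume "p \<in> U"
    then show "\<exists>S. open S \<and> p \<in> S \<and> S \<subseteq> U \<and>
        (\<exists>X::nat \<Rightarrow> 'a \<Rightarrow> 'a. (\<forall>i<q. X i \<in> sections S W) \<and>
           (\<forall>r\<in>S. singular_quotient r = coset (cauchy_bundle U W r) ` span ((\<lambda>i. X i r) ` {..<q}) \<and>
                   quot_dim (cauchy_bundle U W r) ((\<lambda>i. X i r) ` {..<q}) = q))"
      using open_U sec B span_X qd by (intro exI[of _ U] conjI exI[of _ ?X]) simp_all
  qed
qed

lemma weber_structure_W: "weber_structure U W (dim (stable_part L)) q singular_quotient"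
proof -
  have "sub_bundle U (dim (stable_part L) + q + 1) W"
    using sub_bundle_cong[OF W sub_bundle_affine[OF vL]] singular_quotient_rank(1) by simp
  moreover have "derived_flag U W 1 p = UNIV" if p: "p \<in> U" for p
  proof -
    have "derived_flag U W 1 p = affine_distrib (grow L) p"
      using derived_flag_affine[OF vL W_affine p, of 1] by simp
    moreover have "affine_distrib (grow L) p = UNIV"
      using dim_affine[OF p vertical_grow[OF vL]] DIM subspace_affine[OF p]
      by (metis dim_eq_full span_eq_iff)
    ultimately show ?thesis by simp
  qed
  moreover have "sub_bundle U (dim (stable_part L)) (cauchy_bundle U W)"
    by (rule sub_bundle_constant[OF subspace_stable_part[OF vL] cauchy_bundle_W])
  ultimately show ?thesis
    unfolding weber_structure_def
    using totally_regular_affine[OF vL W_affine] q DIM dim_grow singular_quotient_rank sing_lines_W by auto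
qed

text \<open>The space \<open>L\<close> contains the Cauchy bundle, so it is the full preimage of the singular
  sub-bundle, and every other lift is contained in it.\<close>

lemma resolvent_bundle_W: "resolvent_bundle U W singular_quotient (\<lambda>p. {v. J p v \<in> L})"
  unfolding resolvent_bundle_def
proof (intro conjI allI impI ballI)
  show "lifts_to U W singular_quotient (\<lambda>p. {v. J p v \<in> L})"
    unfolding lifts_to_def
  proof (intro conjI ballI)
    show "\<exists>r. sub_bundle U r (\<lambda>p. {v. J p v \<in> L})"
      by (rule exI, rule sub_bundle_constant[OF vertical_subspace[OF vL] refl])
    show "{v. J p v \<in> L} \<subseteq> W p" if "p \<in> U" for p
      unfolding W[OF that] using vertical_in_affine by blast
  qed (simp add: singular_quotient_def)
  fix R' p assume R': "lifts_to U W singular_quotient R'" and p: "p \<in> U"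
  show "R' p \<subseteq> {v. J p v \<in> L}"
    using R' p in_singular_quotient[OF p] unfolding lifts_to_def by blast
qed

end

end


section \<open>The jet coordinates of a partial prolongation\<close>

text \<open>The linear part of the drift of a partial prolongation; it maps \<open>e (Cz l j (Suc h))\<close> to
  \<open>e (Cz l j h)\<close> and annihilates the remaining basis vectors.\<close>

definition jet_shift :: "nat list \<Rightarrow> (jet_coord \<Rightarrow> 'a::euclidean_space) \<Rightarrow> 'a \<Rightarrow> 'a" where
  "jet_shift \<tau> e v = (\<Sum>j=1..length \<tau>. \<Sum>l=1..\<tau> ! (j - 1). \<Sum>h<j.
      (v \<bullet> e (Cz l j (Suc h))) *\<^sub>R e (Cz l j h))"

text \<open>The coordinates whose directions appear in the \<open>i\<close>-th derived bundle of the partial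
  prolongation.\<close>

definition jet_level :: "nat list \<Rightarrow> nat \<Rightarrow> jet_coord set" where
  "jet_level \<tau> i = {Cz l j h |l j h. Cz l j h \<in> jet_coords \<tau> \<and> j \<le> h + i}"

definition tail_sum :: "nat list \<Rightarrow> nat \<Rightarrow> nat" where
  "tail_sum \<tau> i = (\<Sum>j=i..length \<tau>. \<tau> ! (j - 1))"

lemma Cz_in_jet_coords:
  "Cz l j h \<in> jet_coords \<tau> \<longleftrightarrow> j \<in> {1..length \<tau>} \<and> l \<in> {1..\<tau> ! (j - 1)} \<and> h \<le> j"
  by (auto simp: jet_coords_def)

lemma Cz_in_jet_level:
  "Cz l j h \<in> jet_level \<tau> i \<longleftrightarrow>
     j \<in> {1..length \<tau>} \<and> l \<in> {1..\<tau> ! (j - 1)} \<and> h \<le> j \<and> j \<le> h + i"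
  by (auto simp: jet_level_def Cz_in_jet_coords)

lemma jet_level_subset: "jet_level \<tau> i \<subseteq> jet_coords \<tau>"
  and Cx_notin_jet_level: "Cx \<notin> jet_level \<tau> i"
  by (auto simp: jet_level_def)

lemma jet_level_last: "length \<tau> \<le> i \<Longrightarrow> jet_level \<tau> i = jet_coords \<tau> - {Cx}"
  by (auto simp: jet_level_def jet_coords_def)

lemma finite_jet_coords: "finite (jet_coords \<tau>)"
proof -
  have "jet_coords \<tau> \<subseteq> insert Cx (\<Union>j\<in>{1..length \<tau>}. \<Union>l\<in>{1..\<tau> ! (j - 1)}. Cz l j ` {..j})"
    unfolding jet_coords_def by blast
  then show ?thesis by (rule finite_subset) auto
qed

lemma finite_jet_level: "finite (jet_level \<tau> i)"
  by (rule finite_subset[OF jet_level_subset finite_jet_coords])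

text \<open>The new coordinates at step \<open>i + 1\<close> are the \<open>Cz l j h\<close> with \<open>j = h + i + 1\<close>, one for each
  \<open>l\<close> and each \<open>j > i\<close>.\<close>

lemma card_jet_level_Suc: "card (jet_level \<tau> (Suc i)) = card (jet_level \<tau> i) + tail_sum \<tau> (Suc i)"
proof -
  let ?T = "SIGMA j:{Suc i..length \<tau>}. {1..\<tau> ! (j - 1)}"
  let ?g = "\<lambda>(j, l). Cz l j (j - Suc i)"
  have "jet_level \<tau> (Suc i) = jet_level \<tau> i \<union> ?g ` ?T"
  proof (intro equalityI subsetI)
    fix c assume c: "c \<in> jet_level \<tau> (Suc i)"
    then obtain l j h where clj: "c = Cz l j h" by (auto simp: jet_level_def)
    show "c \<in> jet_level \<tau> i \<union> ?g ` ?T"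
    proof (cases "j \<le> h + i")
      case True
      then show ?thesis using c by (simp add: clj Cz_in_jet_level)
    next
      case False
      then have "j = h + Suc i" using c by (simp add: clj Cz_in_jet_level)
      then have "(j, l) \<in> ?T" "c = ?g (j, l)" using c by (auto simp: clj Cz_in_jet_level)
      then show ?thesis by blast
    qed
  next
    fix c assume "c \<in> jet_level \<tau> i \<union> ?g ` ?T"
    then show "c \<in> jet_level \<tau> (Suc i)"
      by (auto simp: Cz_in_jet_level) (auto simp: jet_level_def)
  qed
  moreover have "jet_level \<tau> i \<inter> ?g ` ?T = {}" by (auto simp: Cz_in_jet_level)
  moreover have "card (?g ` ?T) = card ?T" by (rule card_image) (auto simp: inj_on_def)
  ultimately show ?thesis
    using finite_jet_level[of \<tau> i] by (simp add: card_Un_disjoint tail_sum_def)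
qed

lemma tail_sum_Suc: "1 \<le> i \<Longrightarrow> i \<le> length \<tau> \<Longrightarrow> tail_sum \<tau> i = \<tau> ! (i - 1) + tail_sum \<tau> (Suc i)"
  unfolding tail_sum_def by (rule sum.atLeast_Suc_atMost)

lemma tail_sum_last: "\<tau> \<noteq> [] \<Longrightarrow> tail_sum \<tau> (length \<tau>) = last \<tau>"
  by (simp add: tail_sum_def last_conv_nth)

lemma tail_sum_pos:
  assumes "prolongation_type \<tau>" "i \<le> length \<tau>"
  shows "tail_sum \<tau> i > 0"
proof -
  have "length \<tau> \<in> {i..length \<tau>}" using assms(2) by simp
  then have "\<tau> ! (length \<tau> - 1) \<le> tail_sum \<tau> i"
    unfolding tail_sum_def by (intro member_le_sum) auto
  then show ?thesis using assms(1) by (auto simp: prolongation_type_def last_conv_nth)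
qed

locale jet_labelling =
  fixes \<tau> :: "nat list" and e :: "jet_coord \<Rightarrow> 'a::euclidean_space"
  assumes labelling: "coord_labelling \<tau> e" and type: "prolongation_type \<tau>"
begin

abbreviation N :: "'a \<Rightarrow> 'a" where "N \<equiv> jet_shift \<tau> e"
abbreviation level :: "nat \<Rightarrow> 'a set" where "level i \<equiv> span (e ` jet_level \<tau> i)"

lemma bij_e: "bij_betw e (jet_coords \<tau>) Basis"
  using labelling by (simp add: coord_labelling_def)

lemma e_Basis: "c \<in> jet_coords \<tau> \<Longrightarrow> e c \<in> Basis"
  using bij_e by (auto simp: bij_betw_def)

lemma e_inner: "c \<in> jet_coords \<tau> \<Longrightarrow> d \<in> jet_coords \<tau> \<Longrightarrow> e c \<bullet> e d = (if c = d then 1 else 0)"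
  using bij_e e_Basis by (auto simp: bij_betw_def inj_on_def inner_Basis)

lemma Cx_in: "Cx \<in> jet_coords \<tau>"
  by (simp add: jet_coords_def)

lemma linear_shift: "linear N"
  unfolding jet_shift_def
  by (intro linearI)
     (simp_all add: inner_add_left scaleR_add_left sum.distrib scaleR_sum_right)

lemma shift_Cz:
  assumes "Cz l j h \<in> jet_coords \<tau>"
  shows "N (e (Cz l j h)) = (if h = 0 then 0 else e (Cz l j (h - 1)))"
proof -
  have jl: "j \<in> {1..length \<tau>}" "l \<in> {1..\<tau> ! (j - 1)}" "h \<le> j"
    using assms by (simp_all add: Cz_in_jet_coords)
  let ?w = "if h = 0 then 0 else e (Cz l j (h - 1))"
  have "(\<Sum>h'<j'. (e (Cz l j h) \<bullet> e (Cz l' j' (Suc h'))) *\<^sub>R e (Cz l' j' h')) =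
      (if l' = l then if j' = j then ?w else 0 else 0)"
    if "j' \<in> {1..length \<tau>}" "l' \<in> {1..\<tau> ! (j' - 1)}" for j' l'
  proof -
    have "(\<Sum>h'<j'. (e (Cz l j h) \<bullet> e (Cz l' j' (Suc h'))) *\<^sub>R e (Cz l' j' h')) =
        (\<Sum>h'<j'. if h' = h - 1 then if l' = l \<and> j' = j \<and> h \<noteq> 0 then e (Cz l j (h - 1)) else 0 else 0)"
    proof (rule sum.cong[OF refl])
      fix h' assume "h' \<in> {..<j'}"
      then have "Cz l' j' (Suc h') \<in> jet_coords \<tau>" using that by (simp add: Cz_in_jet_coords)
      then show "(e (Cz l j h) \<bullet> e (Cz l' j' (Suc h'))) *\<^sub>R e (Cz l' j' h') =
          (if h' = h - 1 then if l' = l \<and> j' = j \<and> h \<noteq> 0 then e (Cz l j (h - 1)) else 0 else 0)"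
        using e_inner[OF assms] by auto
    qed
    also have "\<dots> = (if l' = l then if j' = j then ?w else 0 else 0)"
      using jl(3) that by (auto simp: sum.delta)
    finally show ?thesis .
  qed
  then have "N (e (Cz l j h)) =
      (\<Sum>j'=1..length \<tau>. \<Sum>l'=1..\<tau> ! (j' - 1). if l' = l then if j' = j then ?w else 0 else 0)"
    unfolding jet_shift_def by (intro sum.cong refl) blast
  also have "\<dots> = (\<Sum>j'=1..length \<tau>. if j' = j then ?w else 0)"
    using jl by (intro sum.cong refl) (auto simp: sum.delta)
  also have "\<dots> = ?w" using jl by (simp add: sum.delta)
  finally show ?thesis .
qed

lemma shift_orth: "N v \<bullet> e Cx = 0"
  unfolding jet_shift_def inner_sum_left
proof (intro sum.neutral ballI)
  fix j l h assume "j \<in> {1..length \<tau>}" "l \<in> {1..\<tau> ! (j - 1)}" "h \<in> {..<j}"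
  then have "Cz l j h \<in> jet_coords \<tau>" by (simp add: Cz_in_jet_coords)
  then show "(v \<bullet> e (Cz l j (Suc h))) *\<^sub>R e (Cz l j h) \<bullet> e Cx = 0"
    using e_inner[OF _ Cx_in] by simp
qed

lemma dim_level: "dim (level i) = card (jet_level \<tau> i)"
proof -
  have "e ` jet_level \<tau> i \<subseteq> Basis" using jet_level_subset e_Basis by blast
  then have "independent (e ` jet_level \<tau> i)" using independent_Basis independent_mono by blast
  then have "dim (level i) = card (e ` jet_level \<tau> i)" by (rule dim_span_eq_card_independent)
  also have "\<dots> = card (jet_level \<tau> i)"
    using bij_e jet_level_subset by (intro card_image) (auto simp: bij_betw_def intro: inj_on_subset)
  finally show ?thesis .
qed

lemma level_orth:
  assumes "x \<in> e ` jet_level \<tau> i"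
  shows "x \<bullet> e Cx = 0"
  using assms e_inner[OF _ Cx_in] jet_level_subset[of \<tau> i] Cx_notin_jet_level[of \<tau> i] by auto

text \<open>Shifting a coordinate lowers \<open>h\<close> by one, so it moves each level into the next. Conversely, a
  new coordinate in the next level is the shift of one in the present level.\<close>

lemma level_Suc: "span (level i \<union> N ` level i) = level (Suc i)"
proof
  have sub: "jet_level \<tau> i \<subseteq> jet_level \<tau> (Suc i)" by (auto simp: jet_level_def)
  have shifted: "N (e c) \<in> level (Suc i)" if c: "c \<in> jet_level \<tau> i" for c
  proof -
    obtain l j h where clj: "c = Cz l j h" using c by (auto simp: jet_level_def)
    have "Cz l j h \<in> jet_coords \<tau>" using c jet_level_subset clj by blast
    note s = shift_Cz[OF this]
    show ?thesis
    proof (cases "h = 0")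
      case True
      then show ?thesis using s by (simp add: clj span_zero)
    next
      case False
      then have "Cz l j (h - 1) \<in> jet_level \<tau> (Suc i)"
        using c by (auto simp: clj Cz_in_jet_level)
      then show ?thesis using s False by (auto simp: clj intro: span_base)
    qed
  qed
  have "N ` level i = span (N ` e ` jet_level \<tau> i)"
    by (rule linear_span_image[OF linear_shift, symmetric])
  also have "\<dots> \<subseteq> level (Suc i)" using shifted by (intro span_minimal) auto
  finally show "span (level i \<union> N ` level i) \<subseteq> level (Suc i)"
    using span_mono[OF image_mono[OF sub], of e] by (intro span_minimal) auto
  have "e c \<in> span (level i \<union> N ` level i)" if c: "c \<in> jet_level \<tau> (Suc i)" for c
  proof (cases "c \<in> jet_level \<tau> i")
    case True
    then show ?thesis by (intro span_base UnI1) (auto intro: span_base)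
  next
    case False
    obtain l j h where clj: "c = Cz l j h" using c by (auto simp: jet_level_def)
    have up: "Cz l j (Suc h) \<in> jet_level \<tau> i" using c False by (auto simp: clj Cz_in_jet_level)
    then have "N (e (Cz l j (Suc h))) = e c"
      using shift_Cz[of l j "Suc h"] jet_level_subset[of \<tau> i] by (auto simp: clj)
    moreover have "N (e (Cz l j (Suc h))) \<in> N ` level i" using up by (intro imageI span_base)
    ultimately show ?thesis by (auto intro: span_base)
  qed
  then show "level (Suc i) \<subseteq> span (level i \<union> N ` level i)" by (intro span_minimal) auto
qed

lemma dim_level_Suc: "dim (level (Suc i)) = dim (level i) + tail_sum \<tau> (Suc i)"
  by (simp only: dim_level card_jet_level_Suc)

lemma DIM_level: "DIM('a) = Suc (dim (level (length \<tau>)))"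
proof -
  have "DIM('a) = card (jet_coords \<tau>)" using bij_e by (simp add: bij_betw_same_card)
  moreover have "dim (level (length \<tau>)) = card (jet_coords \<tau> - {Cx})"
    by (simp only: dim_level) (simp only: jet_level_last[OF order_refl])
  ultimately show ?thesis
    using card_Suc_Diff1[OF finite_jet_coords Cx_in] by (simp only:)
qed

lemma partial_prolongation_eq:
  "partial_prolongation \<tau> e p = span (insert (e Cx + N p) (level 0))"
proof -
  have "jet_level \<tau> 0 = {Cz l j j |l j. j \<in> {1..length \<tau>} \<and> l \<in> {1..\<tau> ! (j - 1)}}"
    by (auto simp: jet_level_def Cz_in_jet_coords)
  moreover have "{e (Cz l j j) |l j. P l j} = e ` {Cz l j j |l j. P l j}" for P by blast
  ultimately have "{e (Cz l j j) |l j. j \<in> {1..length \<tau>} \<and> l \<in> {1..\<tau> ! (j - 1)}} = e ` jet_level \<tau> 0"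
    by simp
  then have "partial_prolongation \<tau> e p = span (insert (e Cx + N p) (e ` jet_level \<tau> 0))"
    by (simp add: partial_prolongation_def jet_shift_def)
  then show ?thesis by (simp only: span_insert span_span)
qed

end

section \<open>Charts onto a partial prolongation\<close>

text \<open>With the identity chart on the whole space, \<open>V\<close> may be the partial prolongation itself.\<close>

locale prolongation_chart = flat_chart U \<theta> + jet_labelling \<tau> e
  for U :: "'a::euclidean_space set" and \<theta> :: "'a \<Rightarrow> 'a"
    and \<tau> :: "nat list" and e :: "jet_coord \<Rightarrow> 'a" +
  fixes V :: "'a distrib"
  assumes nonempty: "U \<noteq> {}"
    and onto: "\<And>p. p \<in> U \<Longrightarrow> frechet_derivative \<theta> (at p) ` V p = partial_prolongation \<tau> e (\<theta> p)"

sublocale prolongation_chart \<subseteq> flat_model U \<theta> "e Cx" "jet_shift \<tau> e"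
  by (intro flat_model.intro flat_chart_axioms flat_model_axioms.intro linear_shift shift_orth)
     (simp add: e_inner Cx_in)

context prolongation_chart
begin

lemma vertical_level: "vertical (level i)"
  by (rule vertical_span) (rule level_orth)

lemma level_funpow: "(grow ^^ i) (level 0) = level i"
  by (induction i) (simp_all add: grow_def level_Suc)

lemma grow_level: "grow (level i) = level (Suc i)"
  by (simp only: grow_def level_Suc)

text \<open>The derivative of the chart is invertible, so its image of \<open>V\<close> determines \<open>V\<close>.\<close>

lemma V_affine: "\<forall>p\<in>U. V p = affine_distrib (level 0) p"
proof
  fix p assume p: "p \<in> U"
  have im: "J p ` V p = span (insert (drift p) (level 0))"
    using onto[OF p] by (simp only: J_def partial_prolongation_eq drift_def)
  have "V p = Ji p ` J p ` V p" by (simp add: image_image Ji_J[OF p])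
  then show "V p = affine_distrib (level 0) p"
    unfolding im affine_distrib_def preimage_J[OF p] .
qed

lemma flag_level: "p \<in> U \<Longrightarrow> derived_flag U V i p = affine_distrib (level i) p"
  using derived_flag_affine[OF vertical_level V_affine] by (simp only: level_funpow)

text \<open>The dimension still grows, because \<open>\<rho>\<^sub>k \<ge> 1\<close>.\<close>

lemma level_not_stable:
  assumes "i < length \<tau>"
  shows "\<not> N ` level i \<subseteq> level i"
proof
  assume "N ` level i \<subseteq> level i"
  then have "grow (level i) = level i" by (simp add: grow_def Un_absorb2)
  then show False
    using dim_level_Suc[of i] tail_sum_pos[OF type, of "Suc i"] assms by (simp add: grow_level)
qed

lemma m_rank_level: "m_rank U V i = Suc (dim (level i))"
  using m_rank_affine[OF vertical_level V_affine nonempty] by (simp only: level_funpow)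

lemma chi_rank_level:
  "chi_rank U V i =
     (if N ` level i \<subseteq> level i then Suc (dim (level i)) else dim (stable_part (level i)))"
  using chi_rank_affine[OF vertical_level V_affine nonempty] by (simp only: level_funpow Let_def)

lemma cauchy_inter_level:
  assumes "i \<in> {1..length \<tau> - 1}" "p \<in> U"
  shows "cauchy_inter U V i p = {v. J p v \<in> level (i - 1)}"
proof -
  have i: "i = Suc (i - 1)" "Suc (i - 1) < length \<tau>" using assms(1) by auto
  have "cauchy_inter U V (Suc (i - 1)) p = {v. J p v \<in> (grow ^^ (i - 1)) (level 0)}"
    by (rule cauchy_inter_affine[OF vertical_level V_affine assms(2)])
       (simp only: level_funpow level_not_stable[OF i(2)] not_False_eq_True)
  then show ?thesis using i(1) by (simp only: level_funpow)
qed

lemma Delta_level: "Delta U V (Suc i) = int (tail_sum \<tau> (Suc i))"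
  by (simp add: Delta_def m_rank_level dim_level_Suc del: dim_span)

lemma flag_top: "p \<in> U \<Longrightarrow> derived_flag U V (length \<tau>) p = UNIV"
  using dim_affine[OF _ vertical_level, of p "length \<tau>"] DIM_level subspace_affine[of p]
    dim_eq_full[of "affine_distrib (level (length \<tau>)) p"]
  by (simp add: flag_level span_eq_iff[THEN iffD2])

lemma derived_length_eq: "derived_length U V = length \<tau>"
  unfolding derived_length_def
proof (rule Least_equality)
  have "level (Suc (length \<tau>)) = level (length \<tau>)" by (simp add: jet_level_last)
  then show "\<forall>p\<in>U. derived_flag U V (Suc (length \<tau>)) p = derived_flag U V (length \<tau>) p"
    by (simp add: flag_level)
  fix i assume eq: "\<forall>p\<in>U. derived_flag U V (Suc i) p = derived_flag U V i p"
  obtain p where p: "p \<in> U" using nonempty by blast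
  have "dim (level (Suc i)) = dim (level i)"
    using eq p dim_affine[OF p vertical_level, of "Suc i"] dim_affine[OF p vertical_level, of i]
    by (simp add: flag_level)
  then have "tail_sum \<tau> (Suc i) = 0" using dim_level_Suc[of i] by simp
  then show "length \<tau> \<le> i" using tail_sum_pos[OF type, of "Suc i"] by (cases "Suc i \<le> length \<tau>") auto
qed

lemma length_pos: "length \<tau> > 0"
  using type by (simp add: prolongation_type_def)

text \<open>The \<open>i\<close>-th difference \<open>\<Delta>\<^sub>i\<close> is \<open>\<rho>\<^sub>i + \<dots> + \<rho>\<^sub>k\<close>, so that \<open>\<Delta>\<^sub>i\<^sub>-\<^sub>1 - \<Delta>\<^sub>i = \<rho>\<^sub>i\<^sub>-\<^sub>1\<close> and
  \<open>\<Delta>\<^sub>k = \<rho>\<^sub>k\<close>.\<close>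

lemma deccel_eq: "deccel U V = map int \<tau>"
proof (rule nth_equalityI)
  show len: "length (deccel U V) = length (map int \<tau>)"
    using length_pos by (simp add: deccel_def Let_def derived_length_eq del: upt_Suc)
  fix n assume "n < length (deccel U V)"
  then have n: "n < length \<tau>" using len by simp
  show "deccel U V ! n = map int \<tau> ! n"
  proof (cases "n < length \<tau> - 1")
    case True
    then show ?thesis
      using n Delta_level[of n] Delta_level[of "Suc n"] tail_sum_Suc[of "Suc n" \<tau>]
      by (simp add: deccel_def Let_def derived_length_eq nth_append numeral_2_eq_2 del: upt_Suc)
  next
    case False
    then have "n = length \<tau> - 1" using n by simp
    then show ?thesis
      using n Delta_level[of n] tail_sum_last[of \<tau>] type
      by (simp add: deccel_def Let_def derived_length_eq nth_append prolongation_type_def last_conv_nth del: upt_Suc)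
  qed
qed

lemma Delta_last: "Delta U V (length \<tau>) = int (last \<tau>)"
  using Delta_level[of "length \<tau> - 1"] tail_sum_last[of \<tau>] length_pos by simp

lemma last_flag_cauchy:
  assumes "p \<in> U" "v \<in> cauchy_bundle U (derived_flag U V (length \<tau> - 1)) p"
  shows "J p v \<bullet> e Cx = 0"
proof -
  have ns: "\<not> N ` level (length \<tau> - 1) \<subseteq> level (length \<tau> - 1)"
    using level_not_stable length_pos by simp
  have "cauchy_bundle U (derived_flag U V (length \<tau> - 1)) p = {v. J p v \<in> stable_part (level (length \<tau> - 1))}"
    unfolding cauchy_flag[OF vertical_level V_affine] level_funpow
    by (rule cauchy_affine[OF vertical_level ns assms(1)])
  with assms(2) have "J p v \<in> level (length \<tau> - 1)" using stable_part_subset by blast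
  then show ?thesis by (rule vertical_orth[OF vertical_level])
qed

text \<open>The top step \<open>L\<^sub>k = L\<^sub>k\<^sub>-\<^sub>1 + N L\<^sub>k\<^sub>-\<^sub>1\<close> adds \<open>\<rho>\<^sub>k\<close> dimensions and fills the orthogonal complement
  of the time direction.\<close>

lemma last_flag_weber:
  assumes "last \<tau> > 1"
  shows "\<exists>c B R. weber_structure U (derived_flag U V (length \<tau> - 1)) c (last \<tau>) B \<and>
      resolvent_bundle U (derived_flag U V (length \<tau> - 1)) B R \<and> integrable_distrib U R \<and>
      (\<forall>p\<in>U. \<forall>v\<in>R p. J p v \<bullet> e Cx = 0)"
proof -
  let ?L = "level (length \<tau> - 1)"
  have top: "grow ?L = level (length \<tau>)" unfolding grow_level using length_pos by simp
  have d: "dim (grow ?L) = dim ?L + last \<tau>"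
    unfolding grow_level dim_level_Suc using length_pos tail_sum_last[of \<tau>] by simp
  have D: "DIM('a) = Suc (dim (grow ?L))" unfolding top by (rule DIM_level)
  have q: "2 \<le> last \<tau>" using assms by simp
  show ?thesis
    by (intro exI conjI, rule weber_structure_W[OF vertical_level flag_level q d D], assumption,
        rule resolvent_bundle_W[OF vertical_level flag_level q d D], assumption,
        rule integrable_preimage[OF _ refl], simp)
       (use vertical_orth[OF vertical_level] in blast)
qed

lemma integrable_cauchy_inter:
  "i \<in> {1..length \<tau> - 1} \<Longrightarrow> integrable_distrib U (cauchy_inter U V i)"
  by (rule integrable_preimage[of "level (i - 1)"]) (simp_all only: cauchy_inter_level subspace_span)

lemma sub_bundle_cauchy_inter:
  "i \<in> {1..length \<tau> - 1} \<Longrightarrow> sub_bundle U (dim (level (i - 1))) (cauchy_inter U V i)"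
  by (rule sub_bundle_constant) (simp_all only: cauchy_inter_level subspace_span)

lemma bundle_rank_cauchy_inter:
  "i \<in> {1..length \<tau> - 1} \<Longrightarrow> bundle_rank U (cauchy_inter U V i) = dim (level (i - 1))"
  by (rule bundle_rank_eqI[OF nonempty]) (simp only: cauchy_inter_level dim_preimage_J)

end

lemma diffeo_on_ident: "diffeo_on UNIV (\<lambda>x::'a::euclidean_space. x)"
proof -
  have "the_inv_into UNIV (\<lambda>x::'a. x) = (\<lambda>x. x)"
    using the_inv_into_f_f[of "\<lambda>x::'a. x" UNIV] by (intro ext) (simp add: inj_on_def)
  then show ?thesis by (simp add: diffeo_on_def smooth_on_ident)
qed

text \<open>The rank conditions compare \<open>V\<close> with the partial prolongation, which is the special case of
  the identity chart; in both cases the ranks are the same functions of the levels.\<close>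

lemma (in prolongation_chart) goursat: "goursat_bundle_of_type U V \<tau>"
proof -
  interpret C: prolongation_chart UNIV "\<lambda>x::'a. x" \<tau> e "partial_prolongation \<tau> e"
    by unfold_locales (simp_all add: diffeo_on_ident)
  have "m_rank U V i = m_rank UNIV (partial_prolongation \<tau> e) i"
    "chi_rank U V i = chi_rank UNIV (partial_prolongation \<tau> e) i" for i
    by (simp_all only: m_rank_level C.m_rank_level chi_rank_level C.chi_rank_level)
  moreover have "integrable_distrib U (cauchy_inter U V i)"
    "sub_bundle U (bundle_rank UNIV (cauchy_inter UNIV (partial_prolongation \<tau> e) i)) (cauchy_inter U V i)"
    if "i \<in> {1..length \<tau> - 1}" for i
    using integrable_cauchy_inter[OF that] sub_bundle_cauchy_inter[OF that]
    by (simp_all only: C.bundle_rank_cauchy_inter[OF that])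
  moreover have "\<exists>c B R. weber_structure U (derived_flag U V (length \<tau> - 1)) c (nat (Delta U V (length \<tau>))) B \<and>
      resolvent_bundle U (derived_flag U V (length \<tau> - 1)) B R \<and> integrable_distrib U R"
    if "Delta U V (length \<tau>) > 1"
  proof -
    have "last \<tau> > 1" using that by (simp add: Delta_last)
    from last_flag_weber[OF this] show ?thesis unfolding Delta_last nat_int by blast
  qed
  moreover have "totally_regular U V" by (rule totally_regular_affine[OF vertical_level V_affine])
  ultimately show ?thesis
    unfolding goursat_bundle_of_type_def derived_length_eq Let_def
    using flag_top type deccel_eq labelling by auto
qed

section \<open>Static feedback equivalence\<close>

theorem theorem5p1:
  fixes M :: "((real^'n) \<times> (real^'m)) set"
    and f :: "real \<Rightarrow> real^'n \<Rightarrow> real^'m \<Rightarrow> real^'n"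
    and U :: "(real \<times> (real^'n) \<times> (real^'m)) set"
  assumes "open M"
    and "smooth_on (UNIV \<times> M) (\<lambda>(t, x, u). f t x u)"
    and "open U" and "U \<noteq> {}" and "U \<subseteq> UNIV \<times> M"
    and "static_feedback_equivalent_brunovsky U (control_distrib f)"
  shows "goursat_bundle U (control_distrib f) \<and>
    (let K = control_distrib f; k = derived_length U K;
         W = derived_flag U K (k - 1); rho = deccel U K ! (k - 1)
     in (rho = 1 \<longrightarrow> (\<forall>p\<in>U. dt \<in> annihilator (cauchy_bundle U W p))) \<and>
        (rho > 1 \<longrightarrow> (\<exists>c B R. weber_structure U W c (nat rho) B \<and> resolvent_bundle U W B R \<and>
                        (\<forall>p\<in>U. dt \<in> annihilator (R p)))))"
proof -
  let ?K = "control_distrib f"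
  obtain \<theta> \<tau> e where sf: "static_feedback U \<theta>" and ty: "prolongation_type \<tau>"
    and lab: "brunovsky_labelling \<tau> e"
    and onto: "\<forall>p\<in>U. frechet_derivative \<theta> (at p) ` ?K p = partial_prolongation \<tau> e (\<theta> p)"
    using assms(6) unfolding static_feedback_equivalent_brunovsky_def by blast
  interpret prolongation_chart U \<theta> \<tau> e ?K
    using sf ty lab onto assms(4)
    by unfold_locales (auto simp: static_feedback_def brunovsky_labelling_def)
  have e: "e Cx = (1, 0, 0)" using lab by (simp add: brunovsky_labelling_def)
  have time: "fst (\<theta> p) = fst p" if "p \<in> U" for p
    using sf that unfolding static_feedback_def by (metis fst_conv prod_cases3)
  \<comment> \<open>The chart preserves time, so its derivative preserves the time component.\<close>
  have dt_J: "dt v = J p v \<bullet> e Cx" if p: "p \<in> U" for p v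
  proof -
    have "((\<lambda>q. fst (\<theta> q)) has_derivative (\<lambda>v. fst (J p v))) (at p)"
      by (rule has_derivative_fst[OF has_derivative_chart[OF p]])
    then have "(fst has_derivative (\<lambda>v. fst (J p v))) (at p)"
      by (rule has_derivative_transform_within_open[OF _ open_U p]) (rule time)
    moreover have "(fst has_derivative fst) (at p)"
      by (rule bounded_linear_imp_has_derivative[OF bounded_linear_fst])
    ultimately have "(\<lambda>v. fst (J p v)) = fst" by (rule has_derivative_unique)
    then have "fst (J p v) = fst v" by metis
    then show ?thesis by (simp add: dt_def e inner_prod_def)
  qed
  have lin: "linear (dt :: real \<times> (real^'n) \<times> (real^'m) \<Rightarrow> real)"
    unfolding dt_def by (rule linear_fst)
  have rho: "deccel U ?K ! (length \<tau> - 1) = int (last \<tau>)"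
    using length_pos by (simp add: deccel_eq last_conv_nth)
  have "dt \<in> annihilator (cauchy_bundle U (derived_flag U ?K (length \<tau> - 1)) p)" if "p \<in> U" for p
    using last_flag_cauchy[OF that] dt_J[OF that] lin by (simp add: annihilator_def)
  moreover have "\<exists>c B R. weber_structure U (derived_flag U ?K (length \<tau> - 1)) c (last \<tau>) B \<and>
      resolvent_bundle U (derived_flag U ?K (length \<tau> - 1)) B R \<and> (\<forall>p\<in>U. dt \<in> annihilator (R p))"
    if gt: "last \<tau> > 1"
  proof -
    obtain c B R where
      w: "weber_structure U (derived_flag U ?K (length \<tau> - 1)) c (last \<tau>) B"
      "resolvent_bundle U (derived_flag U ?K (length \<tau> - 1)) B R"
      and R: "\<forall>p\<in>U. \<forall>v\<in>R p. J p v \<bullet> e Cx = 0"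
      using last_flag_weber[OF gt] by blast
    have "\<forall>p\<in>U. dt \<in> annihilator (R p)"
      using R dt_J lin by (simp add: annihilator_def)
    with w show ?thesis by blast
  qed
  moreover have "goursat_bundle U ?K" unfolding goursat_bundle_def using goursat by blast
  ultimately show ?thesis
    unfolding Let_def derived_length_eq rho nat_int by auto
qed

end
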